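(* Let $(\mathcal M,\varpi)$ be a $2n$-dimensional symplectic manifold, let $H:\mathcal M\times\mathbb R\to\mathbb R$ be a smooth (possibly time-dependent) Hamiltonian which is $T$-periodic in time, and let $z:[0,T]\to\mathcal M$ be a solution of $H$ with $z(0)=z(T)$. Let $\Psi=\{\psi_t\}$ be a periodic symplectic trivialization of $T\mathcal M$ along $z$ and let $L_0\subset T_{z(0)}\mathcal M$ be a Lagrangian subspace. Then for all $N\ge1$ $$\left|\,\mu_{L_0}\big(z^{(N)},\Psi\big)-N\cdot\mu_{L_0}\big(z,\Psi\big)\right|\le n(7N+5).$$ In particular, $\big|\mu_{L_0}(z^{(N)},\Psi)\big|$ has sublinear growth in $N$ (it is bounded above by an affine function of $N$); moreover, if $\mu_{L_0}(z,\Psi)>7n$, then $\mu_{L_0}(z^{(N)},\Psi)$ has superlinear growth in $N$ (it is bounded below by $\alpha N-\beta$ for some constants $\alpha>0$ and $\beta$).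
   Context: Hamiltonian setting. $\vec H$ is the time-dependent Hamiltonian vector field, $\varpi(\vec H,\cdot)=\mathrm dH$; a solution of $H$ is an integral curve of $\vec H$. $z^{(N)}:[0,NT]\to\mathcal M$ is the $N$-fold concatenation of $z$ with itself, again a solution. A periodic symplectic trivialization along $z$ is a smooth family of symplectic isomorphisms $\psi_t:T_{z(0)}\mathcal M\to T_{z(t)}\mathcal M$, $t\in[0,T]$, with $\psi_0=\psi_T=\mathrm{Id}$, extended (smoothly) to $t\in\mathbb R$ by $T$-periodicity. If $\mathcal F^H_{0,t}$ is the flow of $\vec H$ from time $0$ to time $t$, set $\Phi(t)=\psi_t^{-1}\circ\mathrm d\mathcal F^H_{0,t}(z(0))\in\mathrm{Sp}(T_{z(0)}\mathcal M,\varpi_{z(0)})$, $t\in\mathbb R$ (the fundamental solution, $\Phi(0)=\mathrm{Id}$, of the linearized Hamilton equation along $z$). Then $\mu_{L_0}(z^{(N)},\Psi)$ is the $L_0$-Maslov index of the path $[0,NT]\ni t\mapsto\Phi(t)[L_0]$ in the Lagrangian Grassmannian of $(T_{z(0)}\mathcal M,\varpi_{z(0)})$, and $z=z^{(1)}$. Maslov index of Lagrangian paths. Let $(V,\omega)$ be a $2n$-dimensional real symplectic space and $\mathbf\Lambda$ its Grassmannian of Lagrangian subspaces. For transverse $L_0,L_1\in\mathbf\Lambda$ and $L\in\mathbf\Lambda$ transverse to $L_1$, $L$ is the graph of a unique linear map $T:L_0\to L_1$, and $\varphi_{L_0,L_1}(L)$ denotes the symmetric bilinear form $\omega(T\cdot,\cdot)|_{L_0\times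 L_0}$. With $\mathrm n_+$ the maximal dimension of a subspace on which a form is positive definite, the $L_0$-Maslov index $\mu_{L_0}$ is the unique $\mathbb Z$-valued function of continuous paths in $\mathbf\Lambda$ that is invariant under homotopies with fixed endpoints, additive under concatenation, and satisfies $\mu_{L_0}(c)=\mathrm n_+(\varphi_{L_0,L_1}(c(1)))+\dim(c(1)\cap L_0)-\mathrm n_+(\varphi_{L_0,L_1}(c(0)))-\dim(c(0)\cap L_0)$ for every $L_1$ transverse to $L_0$ and every continuous $c:[0,1]\to\mathbf\Lambda$ all of whose values are transverse to $L_1$. *)

theory Defs
  imports "HOL-Analysis.Analysis"
begin

section \<open>Smooth maps between open subsets of normed spaces\<close>

primrec Ck_on :: "nat \<Rightarrow> 'a::real_normed_vector set \<Rightarrow> ('a \<Rightarrow> 'b::real_normed_vector) \<Rightarrow> bool" where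
  "Ck_on 0 S f \<longleftrightarrow> continuous_on S f"
| "Ck_on (Suc k) S f \<longleftrightarrow>
     (\<forall>x\<in>S. f differentiable (at x)) \<and> (\<forall>v. Ck_on k S (\<lambda>x. frechet_derivative f (at x) v))"

text \<open>Only meant for open \<open>S\<close> in a finite-dimensional space.\<close>

definition smooth_on :: "'a::real_normed_vector set \<Rightarrow> ('a \<Rightarrow> 'b::real_normed_vector) \<Rightarrow> bool" where
  "smooth_on S f \<longleftrightarrow> (\<forall>k. Ck_on k S f)"


section \<open>Smooth manifolds\<close>

text \<open>
  The manifold is the whole type \<open>'m\<close>, its topology is the one of the type class, and it is
  modelled on the Euclidean space \<open>'e\<close>. A chart is a pair of a domain and a coordinate map;
  the values of the map outside the domain are irrelevant.
\<close>

type_synonym ('m, 'e) chart = "'m set \<times> ('m \<Rightarrow> 'e)"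

abbreviation cdom :: "('m, 'e) chart \<Rightarrow> 'm set" where "cdom c \<equiv> fst c"
abbreviation cmap :: "('m, 'e) chart \<Rightarrow> 'm \<Rightarrow> 'e" where "cmap c \<equiv> snd c"
abbreviation cimg :: "('m, 'e) chart \<Rightarrow> 'e set" where "cimg c \<equiv> snd c ` fst c"
abbreviation cinv :: "('m, 'e) chart \<Rightarrow> 'e \<Rightarrow> 'm" where "cinv c \<equiv> inv_into (fst c) (snd c)"

definition smooth_atlas ::
  "('m::{t2_space, second_countable_topology}, 'e::euclidean_space) chart set \<Rightarrow> bool" where
  "smooth_atlas A \<longleftrightarrow>
     (\<Union>c\<in>A. cdom c) = UNIV \<and>
     (\<forall>c\<in>A. open (cdom c) \<and> open (cimg c) \<and> homeomorphism (cdom c) (cimg c) (cmap c) (cinv c)) \<and>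
     (\<forall>c\<in>A. \<forall>d\<in>A. smooth_on (cmap c ` (cdom c \<inter> cdom d)) (cmap d \<circ> cinv c))"

text \<open>
  The tangent space at \<open>p\<close> is the model space \<open>'e\<close>: a vector stands for the tangent vector having
  it as coordinates in the chart \<open>chart_at A p\<close>, which depends on the point \<open>p\<close> only.
\<close>

definition chart_at :: "('m, 'e) chart set \<Rightarrow> 'm \<Rightarrow> ('m, 'e) chart" where
  "chart_at A p = (SOME c. c \<in> A \<and> p \<in> cdom c)"

text \<open>\<open>from_chart A c p\<close> sends the coordinates in \<open>c\<close> of a tangent vector at \<open>p\<close> to that vector;
  \<open>to_chart A c p\<close> is the inverse map.\<close>

definition from_chart ::
  "('m, 'e::real_normed_vector) chart set \<Rightarrow> ('m, 'e) chart \<Rightarrow> 'm \<Rightarrow> 'e \<Rightarrow> 'e" where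
  "from_chart A c p = frechet_derivative (cmap (chart_at A p) \<circ> cinv c) (at (cmap c p))"

definition to_chart ::
  "('m, 'e::real_normed_vector) chart set \<Rightarrow> ('m, 'e) chart \<Rightarrow> 'm \<Rightarrow> 'e \<Rightarrow> 'e" where
  "to_chart A c p =
     frechet_derivative (cmap c \<circ> cinv (chart_at A p)) (at (cmap (chart_at A p) p))"

definition tangent_map ::
  "('m, 'e::real_normed_vector) chart set \<Rightarrow> ('m \<Rightarrow> 'm) \<Rightarrow> 'm \<Rightarrow> 'e \<Rightarrow> 'e" where
  "tangent_map A f p =
     frechet_derivative (cmap (chart_at A (f p)) \<circ> f \<circ> cinv (chart_at A p))
       (at (cmap (chart_at A p) p))"


section \<open>Symplectic manifolds\<close>

definition symplectic_form :: "('e::real_vector \<Rightarrow> 'e \<Rightarrow> real) \<Rightarrow> bool" where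
  "symplectic_form \<omega> \<longleftrightarrow>
     (\<forall>u. linear (\<omega> u)) \<and> (\<forall>v. linear (\<lambda>u. \<omega> u v)) \<and> (\<forall>u. \<omega> u u = 0) \<and>
     (\<forall>u. (\<forall>v. \<omega> u v = 0) \<longrightarrow> u = 0)"

definition form_in_chart ::
  "('m, 'e::real_normed_vector) chart set \<Rightarrow> ('m \<Rightarrow> 'e \<Rightarrow> 'e \<Rightarrow> real) \<Rightarrow> ('m, 'e) chart
     \<Rightarrow> 'e \<Rightarrow> 'e \<Rightarrow> 'e \<Rightarrow> real" where
  "form_in_chart A \<Omega> c y u v =
     \<Omega> (cinv c y) (from_chart A c (cinv c y) u) (from_chart A c (cinv c y) v)"

text \<open>The last conjunct is \<open>d\<Omega> = 0\<close>, evaluated on constant vector fields of the chart.\<close>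

definition symplectic_manifold ::
  "('m::{t2_space, second_countable_topology}, 'e::euclidean_space) chart set
     \<Rightarrow> ('m \<Rightarrow> 'e \<Rightarrow> 'e \<Rightarrow> real) \<Rightarrow> bool" where
  "symplectic_manifold A \<Omega> \<longleftrightarrow>
     smooth_atlas A \<and>
     (\<forall>p. symplectic_form (\<Omega> p)) \<and>
     (\<forall>c\<in>A. \<forall>u v. smooth_on (cimg c) (\<lambda>y. form_in_chart A \<Omega> c y u v)) \<and>
     (\<forall>c\<in>A. \<forall>y\<in>cimg c. \<forall>u v w.
        frechet_derivative (\<lambda>x. form_in_chart A \<Omega> c x v w) (at y) u +
        frechet_derivative (\<lambda>x. form_in_chart A \<Omega> c x w u) (at y) v +
        frechet_derivative (\<lambda>x. form_in_chart A \<Omega> c x u v) (at y) w = 0)"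


section \<open>Hamiltonian dynamics\<close>

definition smooth_hamiltonian ::
  "('m, 'e::real_normed_vector) chart set \<Rightarrow> ('m \<times> real \<Rightarrow> real) \<Rightarrow> bool" where
  "smooth_hamiltonian A H \<longleftrightarrow>
     (\<forall>c\<in>A. smooth_on (cimg c \<times> UNIV) (\<lambda>(y, t). H (cinv c y, t)))"

text \<open>\<open>hamiltonian_vf A \<Omega> H t p\<close> is the vector \<open>X\<close> of the tangent space at \<open>p\<close> with
  \<open>\<Omega>\<^sub>p(X, \<cdot>) = dH(\<cdot>, t)(p)\<close>.\<close>

definition hamiltonian_vf ::
  "('m, 'e::real_normed_vector) chart set \<Rightarrow> ('m \<Rightarrow> 'e \<Rightarrow> 'e \<Rightarrow> real) \<Rightarrow> ('m \<times> real \<Rightarrow> real)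
     \<Rightarrow> real \<Rightarrow> 'm \<Rightarrow> 'e" where
  "hamiltonian_vf A \<Omega> H t p =
     (THE X. \<forall>v. \<Omega> p X v =
        frechet_derivative (\<lambda>y. H (cinv (chart_at A p) y, t)) (at (cmap (chart_at A p) p)) v)"

text \<open>Derivatives at end points of \<open>I\<close> are one-sided. Continuity keeps the curve near
  \<open>\<gamma> t\<close>, so that the coordinate map of \<open>chart_at A (\<gamma> t)\<close> is evaluated inside its domain.\<close>

definition integral_curve_on ::
  "('m::topological_space, 'e::real_normed_vector) chart set \<Rightarrow> (real \<Rightarrow> 'm \<Rightarrow> 'e)
     \<Rightarrow> real set \<Rightarrow> (real \<Rightarrow> 'm) \<Rightarrow> bool" where
  "integral_curve_on A X I \<gamma> \<longleftrightarrow>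
     continuous_on I \<gamma> \<and>
     (\<forall>t\<in>I. (cmap (chart_at A (\<gamma> t)) \<circ> \<gamma> has_vector_derivative X t (\<gamma> t)) (at t within I))"

text \<open>
  \<open>F t x\<close> is the flow from time \<open>0\<close> to time \<open>t\<close>, defined for \<open>(t, x)\<close> in the open set \<open>D\<close>.
  By the fundamental theorem on flows a smooth time-dependent vector field \<open>X\<close> has exactly one
  maximal flow: \<open>D\<close> is unique, and so is \<open>F\<close> on \<open>D\<close>.
\<close>

definition maximal_flow ::
  "('m::topological_space, 'e::real_normed_vector) chart set \<Rightarrow> (real \<Rightarrow> 'm \<Rightarrow> 'e)
     \<Rightarrow> (real \<times> 'm) set \<Rightarrow> (real \<Rightarrow> 'm \<Rightarrow> 'm) \<Rightarrow> bool" where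
  "maximal_flow A X D F \<longleftrightarrow>
     open D \<and>
     (\<forall>x. (0, x) \<in> D \<and> F 0 x = x \<and> is_interval {t. (t, x) \<in> D} \<and>
          integral_curve_on A X {t. (t, x) \<in> D} (\<lambda>t. F t x)) \<and>
     (\<forall>I \<gamma>. is_interval I \<and> 0 \<in> I \<and> integral_curve_on A X I \<gamma> \<longrightarrow>
          (\<forall>t\<in>I. (t, \<gamma> 0) \<in> D \<and> F t (\<gamma> 0) = \<gamma> t)) \<and>
     continuous_on D (\<lambda>(t, x). F t x) \<and>
     (\<forall>c\<in>A. \<forall>d\<in>A.
        smooth_on {(t, y). y \<in> cimg c \<and> (t, cinv c y) \<in> D \<and> F t (cinv c y) \<in> cdom d}
          (\<lambda>(t, y). cmap d (F t (cinv c y))))"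

text \<open>The \<open>T\<close>-periodic extension of a function on \<open>[0,T]\<close> with equal values at \<open>0\<close> and \<open>T\<close>.
  For a loop \<open>z\<close>, its restriction to \<open>[0,NT]\<close> is the \<open>N\<close>-fold concatenation \<open>z\<^bsup>(N)\<^esup>\<close>.\<close>

definition periodic_ext :: "real \<Rightarrow> (real \<Rightarrow> 'a) \<Rightarrow> real \<Rightarrow> 'a" where
  "periodic_ext T f t = f (t - T * of_int \<lfloor>t / T\<rfloor>)"

definition periodic_symplectic_trivialization ::
  "('m, 'e::real_normed_vector) chart set \<Rightarrow> ('m \<Rightarrow> 'e \<Rightarrow> 'e \<Rightarrow> real) \<Rightarrow> real \<Rightarrow> (real \<Rightarrow> 'm)
     \<Rightarrow> (real \<Rightarrow> 'e \<Rightarrow> 'e) \<Rightarrow> bool" where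
  "periodic_symplectic_trivialization A \<Omega> T z \<psi> \<longleftrightarrow>
     (\<forall>t\<in>{0..T}. linear (\<psi> t) \<and> bij (\<psi> t) \<and>
        (\<forall>u v. \<Omega> (z t) (\<psi> t u) (\<psi> t v) = \<Omega> (z 0) u v)) \<and>
     \<psi> 0 = id \<and> \<psi> T = id \<and>
     (\<forall>c\<in>A. \<forall>v. smooth_on {t. periodic_ext T z t \<in> cdom c}
        (\<lambda>t. to_chart A c (periodic_ext T z t) (periodic_ext T \<psi> t v)))"

definition fundamental_solution ::
  "('m, 'e::real_normed_vector) chart set \<Rightarrow> (real \<Rightarrow> 'm \<Rightarrow> 'm) \<Rightarrow> real \<Rightarrow> (real \<Rightarrow> 'm)
     \<Rightarrow> (real \<Rightarrow> 'e \<Rightarrow> 'e) \<Rightarrow> real \<Rightarrow> 'e \<Rightarrow> 'e" where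
  "fundamental_solution A F T z \<psi> t = inv (periodic_ext T \<psi> t) \<circ> tangent_map A (F t) (z 0)"


section \<open>The Maslov index of paths of Lagrangian subspaces\<close>

definition lagrangian :: "('e::euclidean_space \<Rightarrow> 'e \<Rightarrow> real) \<Rightarrow> 'e set \<Rightarrow> bool" where
  "lagrangian \<omega> L \<longleftrightarrow> subspace L \<and> 2 * dim L = DIM('e) \<and> (\<forall>u\<in>L. \<forall>v\<in>L. \<omega> u v = 0)"

text \<open>For a subspace \<open>L\<close>, \<open>closest_point L\<close> is the orthogonal projection onto \<open>L\<close>; the usual
  topology of the Grassmannian is the one induced by the embedding of subspaces as projections.
  The topology of the function type is that of pointwise convergence, which on linear maps is the
  norm topology.\<close>

definition lagrangian_grassmannian ::
  "('e::euclidean_space \<Rightarrow> 'e \<Rightarrow> real) \<Rightarrow> 'e set topology" where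
  "lagrangian_grassmannian \<omega> = pullback_topology {L. lagrangian \<omega> L} closest_point euclidean"

text \<open>If \<open>L\<close> is the graph \<open>{x + T x |x. x \<in> L\<^sub>0}\<close> of \<open>T : L\<^sub>0 \<rightarrow> L\<^sub>1\<close>, then for \<open>u \<in> L\<^sub>0\<close> the
  described \<open>y\<close> is \<open>T u\<close>. Outside \<open>L\<^sub>0\<close> the values are irrelevant.\<close>

definition graph_form ::
  "('e::real_vector \<Rightarrow> 'e \<Rightarrow> real) \<Rightarrow> 'e set \<Rightarrow> 'e set \<Rightarrow> 'e \<Rightarrow> 'e \<Rightarrow> real" where
  "graph_form \<omega> L1 L u v = \<omega> (THE y. y \<in> L1 \<and> u + y \<in> L) v"

definition n_plus :: "'e::euclidean_space set \<Rightarrow> ('e \<Rightarrow> 'e \<Rightarrow> real) \<Rightarrow> nat" where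
  "n_plus S B = Max (dim ` {W. subspace W \<and> W \<subseteq> S \<and> (\<forall>w\<in>W. w \<noteq> 0 \<longrightarrow> B w w > 0)})"

definition concat_path :: "(real \<Rightarrow> 'a) \<Rightarrow> (real \<Rightarrow> 'a) \<Rightarrow> real \<Rightarrow> 'a" where
  "concat_path c d t = (if t \<le> 1/2 then c (2 * t) else d (2 * t - 1))"

text \<open>Paths are parametrized by \<open>[0,1]\<close>. These properties determine \<open>\<mu>\<close> on all continuous paths
  in the Lagrangian Grassmannian, and nothing is required on other arguments.\<close>

definition is_maslov_index ::
  "('e::euclidean_space \<Rightarrow> 'e \<Rightarrow> real) \<Rightarrow> 'e set \<Rightarrow> ((real \<Rightarrow> 'e set) \<Rightarrow> int) \<Rightarrow> bool" where
  "is_maslov_index \<omega> L0 \<mu> \<longleftrightarrow>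
     (\<forall>c d. homotopic_with (\<lambda>h. h 0 = c 0 \<and> h 1 = c 1) (top_of_set {0..1})
              (lagrangian_grassmannian \<omega>) c d \<longrightarrow> \<mu> c = \<mu> d) \<and>
     (\<forall>c d. pathin (lagrangian_grassmannian \<omega>) c \<and> pathin (lagrangian_grassmannian \<omega>) d \<and>
              c 1 = d 0 \<longrightarrow> \<mu> (concat_path c d) = \<mu> c + \<mu> d) \<and>
     (\<forall>L1 c. lagrangian \<omega> L1 \<and> L0 \<inter> L1 = {0} \<and> pathin (lagrangian_grassmannian \<omega>) c \<and>
              (\<forall>t\<in>{0..1}. c t \<inter> L1 = {0}) \<longrightarrow>
        \<mu> c = int (n_plus L0 (graph_form \<omega> L1 (c 1))) + int (dim (c 1 \<inter> L0))
            - int (n_plus L0 (graph_form \<omega> L1 (c 0))) - int (dim (c 0 \<inter> L0)))"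

text \<open>The index of \<open>z\<^bsup>(N)\<^esup>\<close>: the value of \<open>\<mu>\<close> on the path \<open>t \<mapsto> \<Phi>(t)[L\<^sub>0]\<close> over \<open>[0,NT]\<close>,
  with time rescaled to \<open>[0,1]\<close>.\<close>

definition iterate_maslov_index ::
  "((real \<Rightarrow> 'e set) \<Rightarrow> int) \<Rightarrow> ('m, 'e::real_normed_vector) chart set \<Rightarrow> (real \<Rightarrow> 'm \<Rightarrow> 'm) \<Rightarrow> real
     \<Rightarrow> (real \<Rightarrow> 'm) \<Rightarrow> (real \<Rightarrow> 'e \<Rightarrow> 'e) \<Rightarrow> 'e set \<Rightarrow> nat \<Rightarrow> int" where
  "iterate_maslov_index \<mu> A F T z \<psi> L0 N =
     \<mu> (\<lambda>s. fundamental_solution A F T z \<psi> (s * (real N * T)) ` L0)"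

end

(* The bound comes out as 2n(N-1). The path over [0,NT] is a concatenation of the paths
   t |-> Phi(t) M^k L0 over [0,T], k < N, where M = Phi(T). To compare Phi(t) L with Phi(t) L0,
   join L0 to L by a path c of Lagrangians transverse to a Lagrangian L1 that is also transverse
   to L0 and to M^-1 L0. The square Phi(t) c(s) gives
     mu(Phi L0) + mu(M c) = mu(c) + mu(Phi L),
   and both c and M c stay in a chart, where the index formula takes values between -n and n.
   That Phi is a continuous path of symplectic maps with Phi(t+T) = Phi(t) Phi(T) follows from the
   invariance of the closed form under the Hamiltonian flow and from uniqueness of the flow. *)

theory Submission
  imports Defs
begin

section \<open>Symplectic linear algebra\<close>

text \<open>The index is known only through its three properties, so a path is evaluated only inside
  a chart of Lagrangians transverse to some L1 that is itself transverse to L0. The path M c is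
  transverse to M L1, and M L1 is transverse to L0 exactly when L1 is transverse to M^-1 L0: this is
  the origin of the third condition on L1. The bound n in a chart comes from the end-point term n_+
  + dim(L \<inter> L0): the graph form vanishes on L \<inter> L0, so the sum cannot exceed dim L0 =
  n. The two arcs c and M c cost n each for every period after the first, which costs nothing; hence
  2n(N-1). On the manifold side the obstacle is that tangent vectors at p are coordinates in the
  chart chosen for p, so the frames jump along the orbit and \<Phi> is not visibly continuous. Every
  analytic statement about \<Phi> is therefore proved near one time t in the chart frozen at F t (z
  0). Moreover the flow is only assumed maximal; that the orbit lives for all times has to be
  derived from periodicity.\<close>

lemma symplectic_form_bilinear: "symplectic_form \<omega> \<Longrightarrow> bilinear \<omega>"
  by (simp add: symplectic_form_def bilinear_def)

lemma symplectic_form_antisym: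
  assumes "symplectic_form \<omega>"
  shows "\<omega> u v = - \<omega> v u"
proof -
  note b = symplectic_form_bilinear[OF assms]
  have "\<omega> (u + v) (u + v) = 0" "\<omega> u u = 0" "\<omega> v v = 0"
    using assms by (auto simp: symplectic_form_def)
  then show ?thesis
    by (simp add: bilinear_ladd[OF b] bilinear_radd[OF b])
qed

lemma bilinear_basis_expansion:
  fixes B :: "'e::euclidean_space \<Rightarrow> 'e \<Rightarrow> real"
  assumes "bilinear B"
  shows "B u v = (\<Sum>i\<in>Basis. \<Sum>j\<in>Basis. B i j * (u \<bullet> i) * (v \<bullet> j))"
proof -
  have "B u v = B (\<Sum>i\<in>Basis. (u \<bullet> i) *\<^sub>R i) (\<Sum>j\<in>Basis. (v \<bullet> j) *\<^sub>R j)"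
    by (simp add: euclidean_representation)
  also have "\<dots> = (\<Sum>(i,j)\<in>Basis \<times> Basis. B ((u \<bullet> i) *\<^sub>R i) ((v \<bullet> j) *\<^sub>R j))"
    by (rule bilinear_sum[OF assms])
  finally show ?thesis
    by (simp add: sum.cartesian_product bilinear_lmul[OF assms] bilinear_rmul[OF assms]
        mult_ac case_prod_unfold)
qed

text \<open>The covector \<open>\<omega> u\<close> turned into a vector by the Euclidean inner
  product. Through it, facts on orthogonal complements and on linear isomorphisms transfer to
  \<omega>.\<close>

definition musical :: "('e::euclidean_space \<Rightarrow> 'e \<Rightarrow> real) \<Rightarrow> 'e \<Rightarrow> 'e" where
  "musical \<omega> u = (\<Sum>b\<in>Basis. \<omega> u b *\<^sub>R b)"

lemma inner_musical:
  assumes "linear (\<omega> u)"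
  shows "musical \<omega> u \<bullet> v = \<omega> u v"
proof -
  have "\<omega> u v = \<omega> u (\<Sum>b\<in>Basis. (v \<bullet> b) *\<^sub>R b)"
    by (simp add: euclidean_representation)
  then show ?thesis
    by (simp add: musical_def inner_sum_left linear_sum[OF assms] linear_cmul[OF assms]
        inner_commute[of v] mult.commute)
qed

lemma musical_iso:
  assumes "symplectic_form \<omega>"
  shows "linear (musical \<omega>)" "inj (musical \<omega>)" "surj (musical \<omega>)"
proof -
  note b = symplectic_form_bilinear[OF assms]
  show l: "linear (musical \<omega>)"
    by (rule linearI) (simp_all add: musical_def bilinear_ladd[OF b] bilinear_lmul[OF b]
        scaleR_left.add sum.distrib scaleR_sum_right)
  show i: "inj (musical \<omega>)"
    unfolding linear_injective_0[OF l]
    using assms inner_musical[of \<omega>] unfolding symplectic_form_def by (metis inner_zero_left)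
  show "surj (musical \<omega>)"
    using linear_injective_imp_surjective[OF l i] by simp
qed

text \<open>Makes the \<open>THE\<close> in \<open>hamiltonian_vf\<close> well defined; it also lets
  a linear functional, such as a coordinate, be written as a pairing with a fixed vector.\<close>

lemma symplectic_form_represents:
  fixes \<omega> :: "'e::euclidean_space \<Rightarrow> 'e \<Rightarrow> real"
  assumes "symplectic_form \<omega>" "linear f"
  shows "\<exists>!X. \<forall>v. \<omega> X v = f v"
proof -
  have l: "linear (\<omega> u)" for u using assms(1) by (simp add: symplectic_form_def)
  obtain X where X: "musical \<omega> X = (\<Sum>b\<in>Basis. f b *\<^sub>R b)"
    using musical_iso(3)[OF assms(1)] by (metis surj_def)
  have "\<omega> X v = f v" for v
  proof -
    have "f v = f (\<Sum>b\<in>Basis. (v \<bullet> b) *\<^sub>R b)" by (simp add: euclidean_representation)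
    also have "\<dots> = (\<Sum>b\<in>Basis. f b *\<^sub>R b) \<bullet> v"
      by (simp add: linear_sum[OF assms(2)] linear_cmul[OF assms(2)] inner_sum_left
          inner_commute[of v] mult.commute)
    finally show ?thesis using inner_musical[of \<omega> X v, OF l] X by simp
  qed
  moreover have "Y = X" if "\<forall>v. \<omega> Y v = \<omega> X v" for Y
  proof -
    have "musical \<omega> Y = musical \<omega> X" using that by (simp add: musical_def)
    then show ?thesis using musical_iso(2)[OF assms(1)] by (simp add: inj_eq)
  qed
  ultimately show ?thesis by metis
qed

definition symplectic_complement :: "('e \<Rightarrow> 'e \<Rightarrow> real) \<Rightarrow> 'e set \<Rightarrow> 'e::euclidean_space set" where
  "symplectic_complement \<omega> W = {u. \<forall>w\<in>W. \<omega> u w = 0}"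

lemma subspace_symplectic_complement:
  assumes "symplectic_form \<omega>"
  shows "subspace (symplectic_complement \<omega> W)"
proof -
  note b = symplectic_form_bilinear[OF assms]
  show ?thesis
    by (auto simp: subspace_def symplectic_complement_def bilinear_ladd[OF b] bilinear_lmul[OF b]
        bilinear_lzero[OF b])
qed

text \<open>The isomorphism \<open>musical \<omega>\<close> carries the symplectic complement onto
  the Euclidean orthogonal complement, whose dimension is known.\<close>

lemma dim_symplectic_complement:
  fixes \<omega> :: "'e::euclidean_space \<Rightarrow> 'e \<Rightarrow> real"
  assumes "symplectic_form \<omega>" "subspace W"
  shows "dim (symplectic_complement \<omega> W) + dim W = DIM('e)"
proof -
  let ?O = "{y \<in> UNIV. \<forall>x\<in>W. orthogonal x y}"
  have l: "linear (\<omega> u)" for u using assms(1) by (simp add: symplectic_form_def)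
  have "musical \<omega> ` symplectic_complement \<omega> W = ?O"
  proof (intro equalityI subsetI)
    fix y assume "y \<in> ?O"
    moreover obtain u where "y = musical \<omega> u" using musical_iso(3)[OF assms(1)] by (metis surj_def)
    ultimately show "y \<in> musical \<omega> ` symplectic_complement \<omega> W"
      by (auto simp: symplectic_complement_def orthogonal_def inner_commute[of _ "musical \<omega> u"]
          inner_musical[of \<omega> u, OF l])
  next
    fix y assume "y \<in> musical \<omega> ` symplectic_complement \<omega> W"
    then show "y \<in> ?O"
      by (auto simp: symplectic_complement_def orthogonal_def)
         (metis inner_commute inner_musical l)
  qed
  moreover have "dim (musical \<omega> ` symplectic_complement \<omega> W) = dim (symplectic_complement \<omega> W)"
    using musical_iso[OF assms(1)] by (intro dim_image_eq) (auto intro: inj_on_subset)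
  moreover have "dim ?O + dim W = dim (UNIV :: 'e set)"
    using dim_subspace_orthogonal_to_vectors[OF assms(2) subspace_UNIV] by simp
  ultimately show ?thesis by simp
qed

lemma dim_isotropic_le:
  fixes \<omega> :: "'e::euclidean_space \<Rightarrow> 'e \<Rightarrow> real"
  assumes "symplectic_form \<omega>" "subspace W" "\<And>u v. u \<in> W \<Longrightarrow> v \<in> W \<Longrightarrow> \<omega> u v = 0"
  shows "2 * dim W \<le> DIM('e)"
proof -
  have "W \<subseteq> symplectic_complement \<omega> W" using assms(3) by (auto simp: symplectic_complement_def)
  then have "dim W \<le> dim (symplectic_complement \<omega> W)" by (rule dim_subset)
  then show ?thesis using dim_symplectic_complement[OF assms(1,2)] by simp
qed

text \<open>The real field is infinite. Take w in V outside all members of I and v in V outside S.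
  If two points of the line w + s v lay in one subspace R, then R would contain v and so also w; the
  first excludes R = S and the second excludes R in I. Hence infinitely many points would need
  infinitely many subspaces.\<close>

lemma subspace_covered_by_finite_union:
  fixes V :: "'a::real_vector set"
  assumes "finite I" "subspace V" "\<And>S. S \<in> I \<Longrightarrow> subspace S" "V \<subseteq> \<Union>I"
  shows "\<exists>S\<in>I. V \<subseteq> S"
  using assms(1,3,4)
proof (induction I)
  case empty
  then show ?case using assms(2) subspace_0 by blast
next
  case (insert S I)
  show ?case
  proof (rule ccontr)
    assume no: "\<not> ?case"
    then have "\<not> V \<subseteq> \<Union>I" using insert by blast
    then obtain w where w: "w \<in> V" "w \<notin> \<Union>I" by auto
    obtain v where v: "v \<in> V" "v \<notin> S" using no by auto
    have "w + s *\<^sub>R v \<in> V" for s :: real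
      using assms(2) v(1) w(1) by (simp add: subspace_add subspace_scale)
    then have "\<exists>R. R \<in> insert S I \<and> w + s *\<^sub>R v \<in> R" for s :: real
      using insert.prems(2) by blast
    then obtain R where R: "\<And>s::real. R s \<in> insert S I" "\<And>s. w + s *\<^sub>R v \<in> R s" by metis
    have "inj R"
    proof (rule injI, rule ccontr)
      fix s t assume st: "R s = R t" "s \<noteq> t"
      have sub: "subspace (R s)" using R(1) insert.prems(1) by auto
      have "(w + s *\<^sub>R v) - (w + t *\<^sub>R v) \<in> R s"
        using R(2)[of s] R(2)[of t] st(1) by (intro subspace_diff[OF sub]) auto
      then have "(s - t) *\<^sub>R v \<in> R s" by (simp add: algebra_simps)
      then have "(1 / (s - t)) *\<^sub>R ((s - t) *\<^sub>R v) \<in> R s" by (rule subspace_scale[OF sub])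
      moreover have "(1 / (s - t)) *\<^sub>R ((s - t) *\<^sub>R v) = v" using st(2) by simp
      ultimately have vR: "v \<in> R s" by metis
      then have "R s \<in> I" using v(2) R(1)[of s] by auto
      moreover have "(w + s *\<^sub>R v) - s *\<^sub>R v \<in> R s"
        using R(2)[of s] vR by (intro subspace_diff[OF sub] subspace_scale[OF sub])
      ultimately show False using w(2) by auto
    qed
    moreover have "finite (range R)" using R(1) insert.hyps(1) by (intro finite_subset[of "range R" "insert S I"]) auto
    ultimately have "finite (UNIV :: real set)" using finite_imageD by blast
    then show False using infinite_UNIV_char_0 by blast
  qed
qed

text \<open>An isotropic subspace \<open>W\<close> that is maximal among those transverse to the given Lagrangians is
  Lagrangian: its complement \<open>W\<^sup>\<omega>\<close> is covered by the subspaces \<open>L + W\<close>, hence contained in one of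
  them, and \<open>W\<^sup>\<omega> \<inter> (L + W)\<close> is isotropic.\<close>

lemma common_transverse_lagrangian:
  fixes \<omega> :: "'e::euclidean_space \<Rightarrow> 'e \<Rightarrow> real"
  assumes \<omega>: "symplectic_form \<omega>" and "finite \<L>" "\<L> \<noteq> {}" and lag: "\<And>L. L \<in> \<L> \<Longrightarrow> lagrangian \<omega> L"
  shows "\<exists>M. lagrangian \<omega> M \<and> (\<forall>L\<in>\<L>. L \<inter> M = {0})"
proof -
  note b = symplectic_form_bilinear[OF \<omega>]
  note bs = bilinear_ladd[OF b] bilinear_radd[OF b] bilinear_lmul[OF b] bilinear_rmul[OF b]
  define P where "P W \<longleftrightarrow> subspace W \<and> (\<forall>u\<in>W. \<forall>v\<in>W. \<omega> u v = 0) \<and> (\<forall>L\<in>\<L>. L \<inter> W = {0})" for W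
  have sL: "subspace L" if "L \<in> \<L>" for L using lag[OF that] by (simp add: lagrangian_def)
  have "P {0}" using sL \<open>\<L> \<noteq> {}\<close> by (auto simp: P_def bilinear_lzero[OF b] subspace_0)
  \<comment> \<open>Dimensions are strictly below \<open>Suc DIM('e)\<close>, so a subspace of
    greatest dimension with property \<open>P\<close> exists.\<close>
  then obtain W where W: "P W" and max: "\<And>U. P U \<Longrightarrow> dim U \<le> dim W"
    using ex_has_greatest_nat[of P "{0}" dim "Suc DIM('e)"] dim_subset_UNIV
    by (metis less_Suc_eq_le)
  have sW: "subspace W" and iW: "\<And>u v. u \<in> W \<Longrightarrow> v \<in> W \<Longrightarrow> \<omega> u v = 0"
    and tW: "\<And>L. L \<in> \<L> \<Longrightarrow> L \<inter> W = {0}" using W by (auto simp: P_def)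
  let ?C = "symplectic_complement \<omega> W"
  have "?C \<subseteq> \<Union>((\<lambda>L. {x + y |x y. x \<in> L \<and> y \<in> W}) ` \<L>)"
  proof (rule ccontr)
    assume "\<not> ?thesis"
    then obtain v where v: "v \<in> ?C" and "v \<notin> \<Union>((\<lambda>L. {x + y |x y. x \<in> L \<and> y \<in> W}) ` \<L>)"
      unfolding subset_eq by auto
    then have nv: "v \<noteq> x + y" if "L \<in> \<L>" "x \<in> L" "y \<in> W" for L x y
      using that by auto
    have vW: "\<omega> v w = 0" "\<omega> w v = 0" if "w \<in> W" for w
      using v that symplectic_form_antisym[OF \<omega>, of w v] by (auto simp: symplectic_complement_def)
    have vnW: "v \<notin> W"
      using nv[OF _ subspace_0[OF sL]] \<open>\<L> \<noteq> {}\<close> by (metis add_0 ex_in_conv)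
    define U where "U = span (insert v W)"
    have U: "u \<in> U \<longleftrightarrow> (\<exists>s. u - s *\<^sub>R v \<in> W)" for u
      unfolding U_def span_insert using sW by (simp add: span_eq_iff[THEN iffD2])
    have "\<omega> u u' = 0" if uu: "u \<in> U" "u' \<in> U" for u u'
    proof -
      obtain s t where st: "u - s *\<^sub>R v \<in> W" "u' - t *\<^sub>R v \<in> W" using uu U by blast
      have "\<omega> ((u - s *\<^sub>R v) + s *\<^sub>R v) ((u' - t *\<^sub>R v) + t *\<^sub>R v) = 0"
        unfolding bs using st vW iW \<omega> by (simp add: symplectic_form_def)
      then show ?thesis by simp
    qed
    moreover have "L \<inter> U = {0}" if L: "L \<in> \<L>" for L
    proof -
      have "x = 0" if x: "x \<in> L" "x \<in> U" for x
      proof -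
        obtain s where s: "x - s *\<^sub>R v \<in> W" using x U by auto
        \<comment> \<open>Otherwise x in L could be solved for v, which would put v in L +
          W.\<close>
        have "s = 0"
        proof (rule ccontr)
          assume "s \<noteq> 0"
          have "(1/s) *\<^sub>R x \<in> L" "(-1/s) *\<^sub>R (x - s *\<^sub>R v) \<in> W"
            using s x(1) by (blast intro: subspace_scale[OF sW] subspace_scale[OF sL[OF L]])+
          moreover have "v = (1/s) *\<^sub>R x + (-1/s) *\<^sub>R (x - s *\<^sub>R v)"
            using \<open>s \<noteq> 0\<close> by (simp add: algebra_simps)
          ultimately show False using nv[OF L] by blast
        qed
        then show ?thesis using s x tW[OF L] by auto
      qed
      moreover have "0 \<in> L" "0 \<in> U" using sL[OF L] by (auto simp: U_def subspace_0 span_0)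
      ultimately show ?thesis by auto
    qed
    ultimately have "P U" by (auto simp: P_def U_def)
    moreover have "dim U = dim W + 1"
      using vnW sW by (simp add: U_def dim_insert span_eq_iff[THEN iffD2])
    ultimately show False using max by fastforce
  qed
  moreover have "subspace S" if "S \<in> (\<lambda>L. {x + y |x y. x \<in> L \<and> y \<in> W}) ` \<L>" for S
    using that sL sW by (auto intro: subspace_sums)
  ultimately obtain L where L: "L \<in> \<L>" "?C \<subseteq> {x + y |x y. x \<in> L \<and> y \<in> W}"
    using subspace_covered_by_finite_union[OF _ subspace_symplectic_complement[OF \<omega>],
        of "(\<lambda>L. {x + y |x y. x \<in> L \<and> y \<in> W}) ` \<L>" W] \<open>finite \<L>\<close> by auto
  have "\<omega> u v = 0" if uv: "u \<in> ?C" "v \<in> ?C" for u v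
  proof -
    obtain l w l' w' where d: "u = l + w" "v = l' + w'" "l \<in> L" "l' \<in> L" "w \<in> W" "w' \<in> W"
      using uv L(2) by blast
    \<comment> \<open>With l, l' and w, w' isotropic pairs and u orthogonal to w', only the term
      \<open>\<omega> w l'\<close> of \<open>\<omega> u v\<close> is left; it vanishes because v is
      orthogonal to w.\<close>
    have "\<omega> l l' = 0" using lag[OF L(1)] d by (simp add: lagrangian_def)
    moreover have "\<omega> u w' = 0" "\<omega> v w = 0"
      using uv d by (auto simp: symplectic_complement_def)
    ultimately show ?thesis
      using iW d symplectic_form_antisym[OF \<omega>, of w l'] by (simp add: bs)
  qed
  then have "2 * dim ?C \<le> DIM('e)"
    by (rule dim_isotropic_le[OF \<omega> subspace_symplectic_complement[OF \<omega>]])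
  moreover have "2 * dim W \<le> DIM('e)" using dim_isotropic_le[OF \<omega> sW iW] by blast
  \<comment> \<open>W and its complement each have at most half the dimension, and together they
    have all of it.\<close>
  ultimately have "2 * dim W = DIM('e)" using dim_symplectic_complement[OF \<omega> sW] by linarith
  then have "lagrangian \<omega> W" using sW iW by (auto simp: lagrangian_def)
  then show ?thesis using tW by blast
qed

lemma symplectic_map_inj:
  assumes "symplectic_form \<omega>" "linear \<phi>" "\<And>u v. \<omega>' (\<phi> u) (\<phi> v) = \<omega> u v" "bilinear \<omega>'"
  shows "inj \<phi>"
  unfolding linear_injective_0[OF assms(2)]
  using assms(1,3) bilinear_lzero[OF assms(4)] unfolding symplectic_form_def by metis

lemma lagrangian_symplectic_image:
  assumes "symplectic_form \<omega>" "linear \<phi>" "\<And>u v. \<omega> (\<phi> u) (\<phi> v) = \<omega> u v" "lagrangian \<omega> L"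
  shows "lagrangian \<omega> (\<phi> ` L)"
proof -
  have "inj \<phi>"
    using symplectic_map_inj[OF assms(1-3)] symplectic_form_bilinear[OF assms(1)] by blast
  then have "dim (\<phi> ` L) = dim L"
    using assms(2) by (intro dim_image_eq) (auto intro: inj_on_subset)
  then show ?thesis
    using assms(2-4) by (auto simp: lagrangian_def linear_subspace_image)
qed

lemma projection_along:
  fixes S R :: "'e::euclidean_space set"
  assumes "subspace S" "subspace R" "S \<inter> R = {0}" "dim S + dim R = DIM('e)"
  shows "\<exists>p. linear p \<and> (\<forall>u. p u \<in> S \<and> u - p u \<in> R) \<and> (\<forall>u\<in>S. p u = u) \<and> (\<forall>u\<in>R. p u = 0)"
proof -
  have "dim {x + y |x y. x \<in> S \<and> y \<in> R} = DIM('e)"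
    using dim_sums_Int[OF assms(1,2)] assms(3,4) by simp
  then have "span {x + y |x y. x \<in> S \<and> y \<in> R} = UNIV" unfolding dim_eq_full .
  moreover have "span {x + y |x y. x \<in> S \<and> y \<in> R} = {x + y |x y. x \<in> S \<and> y \<in> R}"
    unfolding span_eq_iff by (rule subspace_sums[OF assms(1,2)])
  ultimately have sums: "{x + y |x y. x \<in> S \<and> y \<in> R} = UNIV" by simp
  have "\<exists>x. x \<in> S \<and> u - x \<in> R" for u
  proof -
    have "u \<in> {x + y |x y. x \<in> S \<and> y \<in> R}" by (simp only: sums UNIV_I)
    then obtain x y where "u = x + y" "x \<in> S" "y \<in> R" by blast
    then show ?thesis by (intro exI[of _ x]) simp
  qed
  then obtain p where p: "\<And>u. p u \<in> S" "\<And>u. u - p u \<in> R" by metis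
  have uniq: "p u = x" if "x \<in> S" "u - x \<in> R" for u x
  proof -
    have "p u - x \<in> S" using assms(1) p that by (simp add: subspace_diff)
    moreover have "(u - x) - (u - p u) \<in> R" using that(2) p(2) by (rule subspace_diff[OF assms(2)])
    ultimately have "p u - x \<in> S \<inter> R" by simp
    then show ?thesis using assms(3) by simp
  qed
  have "p (u + v) = p u + p v" for u v
    using subspace_add[OF assms(2) p(2)[of u] p(2)[of v]]
    by (intro uniq subspace_add[OF assms(1)] p) (simp add: algebra_simps)
  moreover have "p (r *\<^sub>R u) = r *\<^sub>R p u" for r u
    using subspace_scale[OF assms(2) p(2)[of u], of r]
    by (intro uniq subspace_scale[OF assms(1)] p) (simp add: algebra_simps)
  ultimately have "linear p" by (rule linearI)
  then show ?thesis using p uniq assms(1,2) by (intro exI[of _ p]) (auto simp: subspace_0)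
qed

text \<open>The Lagrangians transverse to \<open>L1\<close> form an affine space; \<open>N\<close> is the displacement from \<open>L0\<close>
  to \<open>L\<close>, realized by the one-parameter group of symplectic shears \<open>Id + s N\<close>.\<close>

lemma lagrangian_shear:
  fixes \<omega> :: "'e::euclidean_space \<Rightarrow> 'e \<Rightarrow> real"
  assumes \<omega>: "symplectic_form \<omega>" and L0: "lagrangian \<omega> L0" and L1: "lagrangian \<omega> L1"
    and L: "lagrangian \<omega> L" and tr: "L0 \<inter> L1 = {0}" "L \<inter> L1 = {0}"
  obtains N where "linear N" "L = (\<lambda>u. u + N u) ` L0"
    "\<And>s u v. \<omega> (u + s *\<^sub>R N u) (v + s *\<^sub>R N v) = \<omega> u v"
    "\<And>s. (\<lambda>u. u + s *\<^sub>R N u) ` L0 \<inter> L1 = {0}"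
proof -
  note b = symplectic_form_bilinear[OF \<omega>]
  note bs = bilinear_ladd[OF b] bilinear_radd[OF b] bilinear_lmul[OF b] bilinear_rmul[OF b]
    bilinear_lsub[OF b] bilinear_rsub[OF b]
  have sub: "subspace L0" "subspace L1" "subspace L"
    and iso: "\<And>u v. u \<in> L0 \<Longrightarrow> v \<in> L0 \<Longrightarrow> \<omega> u v = 0" "\<And>u v. u \<in> L1 \<Longrightarrow> v \<in> L1 \<Longrightarrow> \<omega> u v = 0"
      "\<And>u v. u \<in> L \<Longrightarrow> v \<in> L \<Longrightarrow> \<omega> u v = 0"
    and d: "dim L0 + dim L1 = DIM('e)" "dim L + dim L1 = DIM('e)"
    using L0 L1 L by (auto simp: lagrangian_def)
  obtain p where p: "linear p" "\<And>u. p u \<in> L0" "\<And>u. u - p u \<in> L1" "\<And>u. u \<in> L0 \<Longrightarrow> p u = u"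
      "\<And>u. u \<in> L1 \<Longrightarrow> p u = 0"
    using projection_along[OF sub(1,2) tr(1) d(1)] by blast
  obtain q where q: "linear q" "\<And>u. q u \<in> L" "\<And>u. u - q u \<in> L1" "\<And>u. u \<in> L \<Longrightarrow> q u = u"
      "\<And>u. u \<in> L1 \<Longrightarrow> q u = 0"
    using projection_along[OF sub(3,2) tr(2) d(2)] by blast
  \<comment> \<open>Both p and q project along L1, so N takes values in L1 and kills L1. Hence N
    squares to zero, and Id + s N is a one-parameter group; at s = 1 it agrees with q on L0.\<close>
  define N where "N = (\<lambda>u. q u - p u)"
  have lN: "linear N" unfolding N_def using p(1) q(1) by (simp add: linear_compose_sub)
  have N1: "N u \<in> L1" for u
    using subspace_diff[OF sub(2) p(3)[of u] q(3)[of u]] by (simp add: N_def)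
  have eq: "u + N u = q u" if "u \<in> L0" for u using p(4)[OF that] by (simp add: N_def)
  \<comment> \<open>The preimage of l is p l: the difference l - p l lies in L1 and is killed by q,
    while q fixes l.\<close>
  have "l \<in> (\<lambda>u. u + N u) ` L0" if "l \<in> L" for l
  proof
    show "p l \<in> L0" by (rule p)
    have "q (l - p l) = 0" by (rule q(5)[OF p(3)])
    then show "l = p l + N (p l)" using eq[OF p(2)] q(4)[OF that] linear_diff[OF q(1)] by simp
  qed
  then have im: "L = (\<lambda>u. u + N u) ` L0" using eq q(2) by auto
  \<comment> \<open>The two values are opposite, so N is infinitesimally symplectic. The term
    quadratic in s vanishes as well, because L1 is isotropic; thus the shears preserve \<omega> for
    every s.\<close>
  have Nr: "\<omega> (N u) v = - \<omega> (p u) (q v)" and Nl: "\<omega> u (N v) = \<omega> (p u) (q v)" for u v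
  proof -
    have "\<omega> (N u) v = \<omega> (N u) (q v) + \<omega> (N u) (v - q v)" by (simp add: bs)
    also have "\<dots> = \<omega> (N u) (q v)" using iso(2)[OF N1 q(3)] by simp
    also have "\<dots> = - \<omega> (p u) (q v)" using iso(3)[OF q(2) q(2)] by (simp add: N_def bs)
    finally show "\<omega> (N u) v = - \<omega> (p u) (q v)" .
    have "\<omega> u (N v) = \<omega> (p u) (N v) + \<omega> (u - p u) (N v)" by (simp add: bs)
    also have "\<dots> = \<omega> (p u) (N v)" using iso(2)[OF p(3) N1] by simp
    also have "\<dots> = \<omega> (p u) (q v)" using iso(1)[OF p(2) p(2)] by (simp add: N_def bs)
    finally show "\<omega> u (N v) = \<omega> (p u) (q v)" .
  qed
  have "\<omega> (u + s *\<^sub>R N u) (v + s *\<^sub>R N v) = \<omega> u v" for s u v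
    using Nr[of u v] Nl[of u v] iso(2)[OF N1 N1, of u v] by (simp add: bs)
  moreover have "(\<lambda>u. u + s *\<^sub>R N u) ` L0 \<inter> L1 = {0}" for s
  proof -
    have "u + s *\<^sub>R N u = 0" if "u \<in> L0" "u + s *\<^sub>R N u \<in> L1" for u
    proof -
      have "(u + s *\<^sub>R N u) - s *\<^sub>R N u \<in> L1"
        using that N1 sub(2) by (intro subspace_diff subspace_scale)
      then have "u = 0" using that tr(1) by auto
      then show ?thesis using lN by (simp add: linear_0)
    qed
    moreover have "0 \<in> L0" "0 \<in> L1" using sub by (auto simp: subspace_0)
    ultimately show ?thesis using linear_0[OF lN] by force
  qed
  ultimately show ?thesis using that[OF lN im] by blast
qed

text \<open>On L \<inter> L0 the graph map is zero, so the form vanishes there. A positive definite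
  W therefore meets L \<inter> L0 only in 0, and their sum still fits into L0. It matters that the
  sum of the two terms is bounded by n: bounding them separately would only give 2n.\<close>

lemma n_plus_graph_form_bound:
  fixes \<omega> :: "'e::euclidean_space \<Rightarrow> 'e \<Rightarrow> real"
  assumes \<omega>: "symplectic_form \<omega>" and "DIM('e) = 2 * n" and L0: "lagrangian \<omega> L0"
    and L1: "subspace L1" and L: "subspace L" and tr: "L \<inter> L1 = {0}"
  shows "n_plus L0 (graph_form \<omega> L1 L) + dim (L \<inter> L0) \<le> n"
proof -
  let ?B = "graph_form \<omega> L1 L"
  let ?S = "{W. subspace W \<and> W \<subseteq> L0 \<and> (\<forall>w\<in>W. w \<noteq> 0 \<longrightarrow> ?B w w > 0)}"
  have sL0: "subspace L0" and dL0: "dim L0 = n" using L0 assms(2) by (auto simp: lagrangian_def)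
  have B0: "?B u u = 0" if "u \<in> L" for u
  proof -
    have "(THE y. y \<in> L1 \<and> u + y \<in> L) = 0"
    proof (rule the_equality)
      show "0 \<in> L1 \<and> u + 0 \<in> L" using that L1 by (simp add: subspace_0)
      fix y assume y: "y \<in> L1 \<and> u + y \<in> L"
      then have "(u + y) - u \<in> L" using that L by (intro subspace_diff) auto
      then show "y = 0" using y tr by auto
    qed
    then show ?thesis
      by (simp add: graph_form_def bilinear_lzero[OF symplectic_form_bilinear[OF \<omega>]])
  qed
  have bound: "dim W + dim (L \<inter> L0) \<le> n" if W: "W \<in> ?S" for W
  proof -
    have sK: "subspace (L \<inter> L0)" using L sL0 by (rule subspace_inter)
    have "W \<inter> (L \<inter> L0) = {0}"
      using W B0 L sL0 by (auto simp: subspace_0)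
    then have "dim W + dim (L \<inter> L0) = dim {x + y |x y. x \<in> W \<and> y \<in> L \<inter> L0}"
      using dim_sums_Int[of W "L \<inter> L0"] W sK by simp
    also have "\<dots> \<le> dim L0"
      using W sL0 by (intro dim_subset) (auto intro!: subspace_add)
    finally show ?thesis using dL0 by simp
  qed
  have "dim ` ?S \<subseteq> {..n}" using bound by (auto intro: add_leD1)
  then have "finite (dim ` ?S)" by (rule finite_subset) simp
  moreover have "{0} \<in> ?S" using sL0 by (auto simp: subspace_0)
  ultimately have "Max (dim ` ?S) \<in> dim ` ?S" by (intro Max_in) auto
  then show ?thesis using bound unfolding n_plus_def by auto
qed

section \<open>Paths in the Lagrangian Grassmannian\<close>

lemma closest_point_subspace:
  fixes S :: "'e::euclidean_space set"
  assumes "subspace S"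
  shows "closest_point S v \<in> S" "w \<in> S \<Longrightarrow> (v - closest_point S v) \<bullet> w = 0"
proof -
  let ?p = "closest_point S v"
  have c: "convex S" "closed S" "S \<noteq> {}"
    using assms subspace_0[OF assms] by (auto simp: subspace_imp_convex closed_subspace)
  show p: "?p \<in> S" using closest_point_exists(1)[OF c(2,3)] .
  show "(v - ?p) \<bullet> w = 0" if w: "w \<in> S"
  proof -
    \<comment> \<open>The variational inequality of the nearest point, tested at both
      \<open>?p + w\<close> and \<open>?p - w\<close>, becomes an equality.\<close>
    have "?p + w \<in> S" "?p - w \<in> S" using p w assms by (auto intro: subspace_add subspace_diff)
    then have "(v - ?p) \<bullet> ((?p + w) - ?p) \<le> 0" "(v - ?p) \<bullet> ((?p - w) - ?p) \<le> 0"
      using closest_point_dot[OF c(1,2)] by blast+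
    then show ?thesis by (simp add: inner_minus_right)
  qed
qed

text \<open>The sum over the basis stands in for the operator norm: it tends to 0 as soon as the
  maps converge pointwise.\<close>

lemma norm_linear_diff_le:
  fixes f g :: "'e::euclidean_space \<Rightarrow> 'f::real_normed_vector"
  assumes "linear f" "linear g"
  shows "norm (f w - g w) \<le> (\<Sum>b\<in>Basis. norm (f b - g b)) * norm w"
proof -
  have l: "linear (\<lambda>x. f x - g x)" using assms by (rule linear_compose_sub)
  have "f w - g w = (\<lambda>x. f x - g x) (\<Sum>b\<in>Basis. (w \<bullet> b) *\<^sub>R b)"
    by (simp add: euclidean_representation)
  also have "\<dots> = (\<Sum>b\<in>Basis. (w \<bullet> b) *\<^sub>R (f b - g b))"
    by (simp only: linear_sum[OF l] linear_cmul[OF l])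
  finally have "norm (f w - g w) \<le> (\<Sum>b\<in>Basis. norm ((w \<bullet> b) *\<^sub>R (f b - g b)))"
    by (metis norm_sum)
  also have "\<dots> \<le> (\<Sum>b\<in>Basis. norm (f b - g b) * norm w)"
    by (intro sum_mono) (simp add: Basis_le_norm mult.commute mult_right_mono)
  finally show ?thesis by (simp add: sum_distrib_right)
qed

text \<open>Write the limit projection as p = M0 w0 and compare the projection q onto the moving
  subspace with the nearby vector M y w0 of that subspace. Orthogonality of both projections bounds
  the square of r = |q - M y w0| by r times a quantity tending to 0. Injectivity of M0 is what
  controls preimages by their images.\<close>

lemma tendsto_closest_point_image:
  fixes M :: "'x \<Rightarrow> 'e::euclidean_space \<Rightarrow> 'e"
  assumes lin: "\<forall>\<^sub>F y in F. linear (M y)" and lin0: "linear M0" and inj: "inj M0" and L: "subspace L"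
    and conv: "\<And>v. ((\<lambda>y. M y v) \<longlongrightarrow> M0 v) F"
  shows "((\<lambda>y. closest_point (M y ` L) v) \<longlongrightarrow> closest_point (M0 ` L) v) F"
proof -
  have sub0: "subspace (M0 ` L)" using lin0 L by (rule linear_subspace_image)
  obtain c where c: "c > 0" "\<And>w. c * norm w \<le> norm (M0 w)"
    using linear_inj_bounded_below_pos[OF lin0 inj] by (metis mult.commute)
  define p where "p = closest_point (M0 ` L) v"
  obtain w0 where w0: "w0 \<in> L" "p = M0 w0" using closest_point_subspace(1)[OF sub0] p_def by blast
  define e where "e y = (\<Sum>b\<in>Basis. norm (M y b - M0 b))" for y
  define d where "d y = norm (M y w0 - M0 w0)" for y
  have e0: "(e \<longlongrightarrow> 0) F"
    unfolding e_def by (rule tendsto_null_sum) (metis conv LIM_zero tendsto_norm_zero)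
  have d0: "(d \<longlongrightarrow> 0) F"
    unfolding d_def by (metis conv LIM_zero tendsto_norm_zero)
  have "\<forall>\<^sub>F y in F. e y < c / 2" using c(1) e0 by (intro order_tendstoD) auto
  then have bound: "\<forall>\<^sub>F y in F. norm (closest_point (M y ` L) v - p) \<le> 2 / c * norm (v - p) * e y + 2 * d y"
    using lin
  proof eventually_elim
    case (elim y)
    have e: "norm (M y w - M0 w) \<le> e y * norm w" for w
      unfolding e_def by (rule norm_linear_diff_le[OF elim(2) lin0])
    have sub: "subspace (M y ` L)" using elim(2) L by (rule linear_subspace_image)
    define q where "q = closest_point (M y ` L) v"
    obtain w where w: "w \<in> L" "q = M y w" using closest_point_subspace(1)[OF sub] q_def by blast
    define w' where "w' = w - w0"
    have w': "w' \<in> L" "M y w' = q - M y w0"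
      using w w0 L linear_diff[OF elim(2)] by (auto simp: w'_def subspace_diff)
    define r where "r = norm (M y w')"
    \<comment> \<open>For y with e y < c/2 half of the lower bound c for M0 survives, so M y is
      bounded below by c/2 on this vector.\<close>
    have "c * norm w' \<le> norm (M0 w')" by (rule c)
    also have "\<dots> \<le> r + norm (M y w' - M0 w')"
      unfolding r_def by (metis norm_triangle_sub norm_minus_commute)
    also have "\<dots> \<le> r + e y * norm w'" using e by simp
    also have "e y * norm w' \<le> c / 2 * norm w'" using elim(1) by (intro mult_right_mono) auto
    finally have wr: "norm w' \<le> 2 / c * r" using c(1) by (simp add: field_simps)
    have e_nn: "0 \<le> e y" unfolding e_def by (simp add: sum_nonneg)
    have "r * r = M y w' \<bullet> M y w'" by (simp add: r_def power2_norm_eq_inner[symmetric] power2_eq_square)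
    also have "\<dots> = (v - M y w0) \<bullet> M y w' - (v - q) \<bullet> M y w'"
      unfolding w'(2) by (simp add: inner_diff_left)
    also have "(v - q) \<bullet> M y w' = 0"
      unfolding q_def using w'(1) by (intro closest_point_subspace(2)[OF sub]) auto
    also have "(v - M y w0) \<bullet> M y w' = (v - p) \<bullet> M y w' + (p - M y w0) \<bullet> M y w'"
      by (simp add: inner_diff_left)
    \<comment> \<open>Since v - p is orthogonal to M0 w', only the small difference M y w' - M0 w'
      contributes.\<close>
    also have "(v - p) \<bullet> M y w' = (v - p) \<bullet> (M y w' - M0 w')"
      using closest_point_subspace(2)[OF sub0, of "M0 w'" v] w'(1)
      by (simp add: inner_diff_right p_def)
    also have "\<dots> \<le> norm (v - p) * (e y * norm w')"
      using norm_cauchy_schwarz[of "v - p" "M y w' - M0 w'"] mult_left_mono[OF e[of w'], of "norm (v - p)"]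
      by simp
    also have "\<dots> \<le> norm (v - p) * (e y * (2 / c * r))"
      using wr e_nn by (intro mult_left_mono) auto
    also have "(p - M y w0) \<bullet> M y w' \<le> d y * r"
      using norm_cauchy_schwarz[of "p - M y w0" "M y w'"]
      by (simp add: d_def r_def w0(2) norm_minus_commute)
    finally have "r * r \<le> (2 / c * norm (v - p) * e y + d y) * r"
      by (simp add: algebra_simps)
    moreover have "0 \<le> 2 / c * norm (v - p) * e y + d y"
      using c(1) e_nn by (simp add: d_def)
    ultimately have "r \<le> 2 / c * norm (v - p) * e y + d y"
      by (cases "r = 0") (auto simp: r_def dest: mult_right_le_imp_le)
    moreover have "norm (q - p) \<le> r + d y"
      using norm_triangle_ineq[of "q - M y w0" "M y w0 - p"] by (simp add: r_def w'(2) d_def w0(2))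
    ultimately show ?case by (simp add: q_def)
  qed
  have "((\<lambda>y. 2 / c * norm (v - p) * e y + 2 * d y) \<longlongrightarrow> 2 / c * norm (v - p) * 0 + 2 * 0) F"
    by (intro tendsto_intros e0 d0)
  then have "((\<lambda>y. closest_point (M y ` L) v - p) \<longlongrightarrow> 0) F"
    using Lim_null_comparison[OF bound] by simp
  then show ?thesis unfolding p_def by (rule LIM_zero_cancel)
qed

text \<open>The topology is pulled back along orthogonal projections with pointwise convergence, so
  the preceding limit, vector by vector, suffices. The parameter space is arbitrary because both a
  time axis and a square will be mapped.\<close>

lemma continuous_map_lagrangian_image:
  fixes M :: "'x::topological_space \<Rightarrow> 'e::euclidean_space \<Rightarrow> 'e"
  assumes \<omega>: "symplectic_form \<omega>" and L: "lagrangian \<omega> L"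
    and M: "\<And>x. linear (M x)" "\<And>x u v. \<omega> (M x u) (M x v) = \<omega> u v"
    and cont: "\<And>v. continuous_on UNIV (\<lambda>x. M x v)"
  shows "continuous_map euclidean (lagrangian_grassmannian \<omega>) (\<lambda>x. M x ` L)"
  unfolding lagrangian_grassmannian_def
proof (rule continuous_map_pullback')
  have "continuous_on UNIV (\<lambda>x. closest_point (M x ` L))"
  proof (rule continuous_on_coordinatewise_then_product)
    fix v
    have "((\<lambda>y. closest_point (M y ` L) v) \<longlongrightarrow> closest_point (M x ` L) v) (at x)" for x
    proof (rule tendsto_closest_point_image)
      show "inj (M x)" by (rule symplectic_map_inj[OF \<omega> M symplectic_form_bilinear[OF \<omega>]])
      show "((\<lambda>y. M y v) \<longlongrightarrow> M x v) (at x)" for v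
        using cont[of v] by (simp add: continuous_on_def)
    qed (use M L in \<open>auto simp: lagrangian_def\<close>)
    then show "continuous_on UNIV (\<lambda>x. closest_point (M x ` L) v)" by (simp add: continuous_on_def)
  qed
  then show "continuous_map euclidean euclidean (closest_point \<circ> (\<lambda>x. M x ` L))"
    by (simp add: o_def)
  show "topspace euclidean \<subseteq> (\<lambda>x. M x ` L) -` {L. lagrangian \<omega> L}"
    using lagrangian_symplectic_image[OF \<omega> M L] by auto
qed

text \<open>All homotopies are straight lines in a vector space of parameters, transported by f;
  none has to be constructed inside the Grassmannian. This covers reparametrization as well as the
  two ways around a square.\<close>

lemma maslov_index_homotopy:
  fixes f :: "'x::real_normed_vector \<Rightarrow> 'e::euclidean_space set"
  assumes mu: "is_maslov_index \<omega> L0 \<mu>"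
    and f: "continuous_map euclidean (lagrangian_grassmannian \<omega>) f"
    and pq: "path p" "path q" "p 0 = q 0" "p 1 = q 1"
  shows "\<mu> (\<lambda>t. f (p t)) = \<mu> (\<lambda>t. f (q t))"
proof -
  define h where "h = (\<lambda>(u::real, t). (1 - u) *\<^sub>R p t + u *\<^sub>R q t)"
  have "continuous_on ({0..1} \<times> {0..1}) h"
    unfolding h_def case_prod_unfold using pq(1,2) unfolding path_def
    by (intro continuous_intros) (auto elim: continuous_on_compose2 intro!: continuous_intros)
  then have "continuous_map (prod_topology (top_of_set {0..1}) (top_of_set {0..1})) euclidean h"
    by (simp add: prod_topology_subtopology_eu)
  then have "continuous_map (prod_topology (top_of_set {0..1}) (top_of_set {0..1}))
      (lagrangian_grassmannian \<omega>) (f \<circ> h)"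
    using f by (rule continuous_map_compose)
  moreover have "(1 - u) *\<^sub>R q 0 + u *\<^sub>R q 0 = q 0" "(1 - u) *\<^sub>R q 1 + u *\<^sub>R q 1 = q 1" for u :: real
    by (simp_all add: algebra_simps)
  ultimately have "homotopic_with (\<lambda>h. h 0 = f (p 0) \<and> h 1 = f (p 1)) (top_of_set {0..1})
      (lagrangian_grassmannian \<omega>) (\<lambda>t. f (p t)) (\<lambda>t. f (q t))"
    unfolding homotopic_with_def by (intro exI[of _ "f \<circ> h"]) (simp add: h_def pq)
  then show ?thesis
    using mu[unfolded is_maslov_index_def, THEN conjunct1, rule_format, of "\<lambda>t. f (p t)"] by blast
qed

lemma pathin_comp:
  assumes "continuous_map euclidean X f" "path p"
  shows "pathin X (\<lambda>t. f (p t))"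
proof -
  have "continuous_map (top_of_set {0..1}) euclidean p" using assms(2) by (simp add: path_def)
  from continuous_map_compose[OF this assms(1)] show ?thesis by (simp add: pathin_def o_def)
qed

lemma maslov_index_join:
  fixes f :: "'x::real_normed_vector \<Rightarrow> 'e::euclidean_space set"
  assumes mu: "is_maslov_index \<omega> L0 \<mu>"
    and f: "continuous_map euclidean (lagrangian_grassmannian \<omega>) f"
    and pq: "path p" "path q" "p 1 = q 0"
  shows "\<mu> (\<lambda>t. f ((p +++ q) t)) = \<mu> (\<lambda>t. f (p t)) + \<mu> (\<lambda>t. f (q t))"
proof -
  have "(\<lambda>t. f ((p +++ q) t)) = concat_path (\<lambda>t. f (p t)) (\<lambda>t. f (q t))"
    by (auto simp: concat_path_def joinpaths_def fun_eq_iff)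
  then show ?thesis
    using mu pathin_comp[OF f pq(1)] pathin_comp[OF f pq(2)] pq(3) unfolding is_maslov_index_def by simp
qed

lemma maslov_index_chart_bound:
  fixes \<omega> :: "'e::euclidean_space \<Rightarrow> 'e \<Rightarrow> real"
  assumes \<omega>: "symplectic_form \<omega>" and n: "DIM('e) = 2 * n" and L0: "lagrangian \<omega> L0"
    and mu: "is_maslov_index \<omega> L0 \<mu>" and L1: "lagrangian \<omega> L1" "L0 \<inter> L1 = {0}"
    and c: "pathin (lagrangian_grassmannian \<omega>) c" "\<And>t. c t \<inter> L1 = {0}"
      "\<And>t. lagrangian \<omega> (c t)"
  shows "\<bar>\<mu> c\<bar> \<le> int n"
proof -
  have "\<mu> c = int (n_plus L0 (graph_form \<omega> L1 (c 1))) + int (dim (c 1 \<inter> L0))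
            - int (n_plus L0 (graph_form \<omega> L1 (c 0))) - int (dim (c 0 \<inter> L0))"
    using mu L1 c(1,2) unfolding is_maslov_index_def by blast
  moreover have "n_plus L0 (graph_form \<omega> L1 (c t)) + dim (c t \<inter> L0) \<le> n" for t
    using L1 c n_plus_graph_form_bound[OF \<omega> n L0] by (auto simp: lagrangian_def)
  from this[of 0] this[of 1] show ?thesis using calculation by linarith
qed

text \<open>The boundary of the square \<open>(s, t) \<mapsto> \<Phi> (t T) (A\<^sub>s L0)\<close>, where \<open>A\<^sub>s L0\<close> runs from \<open>L0\<close> to \<open>L\<close>,
  is null-homotopic. Two opposite sides are the paths to be compared, and the other two stay in the
  charts given by \<open>L1\<close> and \<open>\<Phi> T ` L1\<close>.\<close>

lemma maslov_index_change_start: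
  fixes \<omega> :: "'e::euclidean_space \<Rightarrow> 'e \<Rightarrow> real" and \<Phi> :: "real \<Rightarrow> 'e \<Rightarrow> 'e"
  assumes \<omega>: "symplectic_form \<omega>" and n: "DIM('e) = 2 * n" and L0: "lagrangian \<omega> L0"
    and mu: "is_maslov_index \<omega> L0 \<mu>" and L: "lagrangian \<omega> L"
    and \<Phi>: "\<And>t. linear (\<Phi> t)" "\<And>t u v. \<omega> (\<Phi> t u) (\<Phi> t v) = \<omega> u v" "\<Phi> 0 = id"
    and cont: "\<And>v. continuous_on UNIV (\<lambda>t. \<Phi> t v)"
  shows "\<bar>\<mu> (\<lambda>t. \<Phi> (t * T) ` L) - \<mu> (\<lambda>t. \<Phi> (t * T) ` L0)\<bar> \<le> 2 * int n"
proof -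
  note b = symplectic_form_bilinear[OF \<omega>]
  have inj: "inj (\<Phi> T)" by (rule symplectic_map_inj[OF \<omega> \<Phi>(1,2) b])
  then have bij: "bij (\<Phi> T)" using linear_injective_imp_surjective[OF \<Phi>(1) inj] by (simp add: bij_def)
  define K where "K = inv (\<Phi> T) ` L0"
  have "linear (inv (\<Phi> T))" using bij \<Phi>(1) by (simp add: bij_is_inj inj_linear_imp_inv_linear)
  moreover have "\<omega> (inv (\<Phi> T) u) (inv (\<Phi> T) v) = \<omega> u v" for u v
    using \<Phi>(2)[of T "inv (\<Phi> T) u" "inv (\<Phi> T) v"] bij by (simp add: bij_is_surj surj_f_inv_f)
  ultimately have K: "lagrangian \<omega> K" unfolding K_def by (intro lagrangian_symplectic_image[OF \<omega>] L0)
  have "finite {L0, L, K}" "{L0, L, K} \<noteq> {}" "\<And>R. R \<in> {L0, L, K} \<Longrightarrow> lagrangian \<omega> R"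
    using L0 L K by auto
  from common_transverse_lagrangian[OF \<omega> this]
  obtain L1 where L1: "lagrangian \<omega> L1" "L0 \<inter> L1 = {0}" "L \<inter> L1 = {0}" "K \<inter> L1 = {0}" by auto
  obtain N where N: "linear N" "L = (\<lambda>u. u + N u) ` L0"
    "\<And>s u v. \<omega> (u + s *\<^sub>R N u) (v + s *\<^sub>R N v) = \<omega> u v"
    "\<And>s. (\<lambda>u. u + s *\<^sub>R N u) ` L0 \<inter> L1 = {0}"
    using lagrangian_shear[OF \<omega> L0 L1(1) L L1(2,3)] by blast
  define f where "f = (\<lambda>x :: real \<times> real. (\<lambda>u. \<Phi> (snd x * T) (u + fst x *\<^sub>R N u)) ` L0)"
  have lM: "linear (\<lambda>u. \<Phi> (t * T) (u + s *\<^sub>R N u))" for s t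
    by (rule linearI) (simp_all add: linear_add[OF \<Phi>(1)] linear_add[OF N(1)] linear_cmul[OF \<Phi>(1)]
        linear_cmul[OF N(1)] algebra_simps)
  have contf: "continuous_map euclidean (lagrangian_grassmannian \<omega>) f"
    unfolding f_def
  proof (rule continuous_map_lagrangian_image[OF \<omega> L0])
    show "continuous_on UNIV (\<lambda>x :: real \<times> real. \<Phi> (snd x * T) (v + fst x *\<^sub>R N v))" for v
    proof -
      \<comment> \<open>By linearity \<open>\<Phi> t (v + s N v)\<close> splits into
        \<open>\<Phi> t v\<close> and s times \<open>\<Phi> t (N v)\<close>, so joint continuity
        reduces to continuity in t at fixed vectors.\<close>
      have "continuous_on UNIV (\<lambda>x :: real \<times> real. \<Phi> (snd x * T) w)" for w
        by (rule continuous_on_compose2[OF cont]) (auto intro!: continuous_intros)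
      then show ?thesis
        unfolding linear_add[OF \<Phi>(1)] linear_cmul[OF \<Phi>(1)] by (intro continuous_intros)
    qed
  qed (use lM N(3) \<Phi>(2) in auto)
  have lagf: "lagrangian \<omega> (f x)" for x
    unfolding f_def by (rule lagrangian_symplectic_image[OF \<omega> lM _ L0]) (simp add: \<Phi>(2) N(3))
  \<comment> \<open>The sides of the square: \<open>p1\<close> and \<open>p4\<close> give the paths
    to be compared (s = 0 and s = 1), \<open>p3\<close> gives the arc from L0 to L (t = 0), and
    \<open>p2\<close> its image under \<open>\<Phi> T\<close> (t = 1).\<close>
  define p1 p2 p3 p4 :: "real \<Rightarrow> real \<times> real" where
    p: "p1 = (\<lambda>t. (0, t))" "p2 = (\<lambda>s. (s, 1))" "p3 = (\<lambda>s. (s, 0))" "p4 = (\<lambda>t. (1, t))"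
  have path: "path p1" "path p2" "path p3" "path p4"
    unfolding p path_def by (intro continuous_intros)+
  have "path (p1 +++ p2)" "path (p3 +++ p4)"
    using path by (auto intro!: path_join_imp simp: pathstart_def pathfinish_def p)
  then have "\<mu> (\<lambda>t. f ((p1 +++ p2) t)) = \<mu> (\<lambda>t. f ((p3 +++ p4) t))"
    by (intro maslov_index_homotopy[OF mu contf]) (auto simp: p joinpaths_def)
  then have eq: "\<mu> (\<lambda>t. f (p1 t)) + \<mu> (\<lambda>t. f (p2 t)) = \<mu> (\<lambda>t. f (p3 t)) + \<mu> (\<lambda>t. f (p4 t))"
    using maslov_index_join[OF mu contf path(1,2)] maslov_index_join[OF mu contf path(3,4)]
    by (simp add: p)
  have sides: "(\<lambda>t. f (p1 t)) = (\<lambda>t. \<Phi> (t * T) ` L0)" "(\<lambda>t. f (p4 t)) = (\<lambda>t. \<Phi> (t * T) ` L)"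
    by (auto simp: f_def p N(2) image_image)
  have "f (p3 s) \<inter> L1 = {0}" for s using N(4)[of s] by (simp add: f_def p \<Phi>(3))
  then have b3: "\<bar>\<mu> (\<lambda>t. f (p3 t))\<bar> \<le> int n"
    using lagf by (intro maslov_index_chart_bound[OF \<omega> n L0 mu L1(1,2) pathin_comp[OF contf path(3)]]) auto
  have "f (p2 s) \<inter> \<Phi> T ` L1 = {0}" for s
  proof -
    have "f (p2 s) = \<Phi> T ` ((\<lambda>u. u + s *\<^sub>R N u) ` L0)" by (auto simp: f_def p)
    then have "f (p2 s) \<inter> \<Phi> T ` L1 = \<Phi> T ` {0}" by (simp only: image_Int[OF inj, symmetric] N(4))
    then show ?thesis using linear_0[OF \<Phi>(1)] by simp
  qed
  \<comment> \<open>Here the transversality of K and L1 enters: it is the same condition moved by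
    \<open>\<Phi> T\<close>.\<close>
  moreover have "L0 \<inter> \<Phi> T ` L1 = {0}"
  proof -
    have "L0 = \<Phi> T ` K" using bij by (simp add: K_def image_image bij_is_surj surj_f_inv_f)
    then have "L0 \<inter> \<Phi> T ` L1 = \<Phi> T ` {0}" by (simp only: image_Int[OF inj, symmetric] L1(4))
    then show ?thesis using linear_0[OF \<Phi>(1)] by simp
  qed
  moreover have "lagrangian \<omega> (\<Phi> T ` L1)" by (rule lagrangian_symplectic_image[OF \<omega> \<Phi>(1,2) L1(1)])
  ultimately have b2: "\<bar>\<mu> (\<lambda>t. f (p2 t))\<bar> \<le> int n"
    using lagf by (intro maslov_index_chart_bound[OF \<omega> n L0 mu _ _ pathin_comp[OF contf path(2)]]) auto
  show ?thesis using eq b2 b3 unfolding sides by linarith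
qed

text \<open>Each step of the induction splits off the last period, on which the path is
  \<open>\<Phi> t\<close> applied to another starting Lagrangian. For k = 0 there is nothing to
  compare, so \<open>Suc k\<close> periods cost only k errors.\<close>

lemma maslov_index_iterate_bound:
  fixes \<omega> :: "'e::euclidean_space \<Rightarrow> 'e \<Rightarrow> real" and \<Phi> :: "real \<Rightarrow> 'e \<Rightarrow> 'e"
  assumes \<omega>: "symplectic_form \<omega>" and n: "DIM('e) = 2 * n" and L0: "lagrangian \<omega> L0"
    and mu: "is_maslov_index \<omega> L0 \<mu>"
    and \<Phi>: "\<And>t. linear (\<Phi> t)" "\<And>t u v. \<omega> (\<Phi> t u) (\<Phi> t v) = \<omega> u v" "\<Phi> 0 = id"
    and cont: "\<And>v. continuous_on UNIV (\<lambda>t. \<Phi> t v)"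
    and mono: "\<And>t. \<Phi> (t + T) = \<Phi> t \<circ> \<Phi> T"
  shows "\<bar>\<mu> (\<lambda>s. \<Phi> (s * (real (Suc k) * T)) ` L0) - int (Suc k) * \<mu> (\<lambda>s. \<Phi> (s * T) ` L0)\<bar> \<le> 2 * int n * int k"
proof (induction k)
  case (Suc k)
  \<comment> \<open>The induction hypothesis is used twice, at t + T to peel off one period and at T
    to put the product back together; hence t is arbitrary.\<close>
  have per: "\<Phi> (t + real j * T) = \<Phi> t \<circ> \<Phi> (real j * T)" for t j
  proof (induction j arbitrary: t)
    case (Suc j)
    have "\<Phi> (t + real (Suc j) * T) = \<Phi> ((t + T) + real j * T)" by (simp add: algebra_simps)
    also have "\<dots> = \<Phi> t \<circ> (\<Phi> T \<circ> \<Phi> (real j * T))" by (simp only: Suc mono o_assoc)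
    also have "\<Phi> T \<circ> \<Phi> (real j * T) = \<Phi> (real (Suc j) * T)"
      unfolding Suc[symmetric] by (simp add: algebra_simps)
    finally show ?case .
  qed (simp add: \<Phi>(3))
  define f where "f = (\<lambda>t. \<Phi> t ` L0)"
  have contf: "continuous_map euclidean (lagrangian_grassmannian \<omega>) f"
    unfolding f_def by (rule continuous_map_lagrangian_image[OF \<omega> L0 \<Phi>(1,2) cont])
  define m where "m = Suc k"
  define p q r where pqr: "p = (\<lambda>s. s * (real (Suc m) * T))" "q = (\<lambda>s. s * (real m * T))"
    "r = (\<lambda>s::real. s * T + real m * T)"
  have path: "path p" "path q" "path r" unfolding pqr path_def by (intro continuous_intros)+
  have "path (q +++ r)"
    using path by (intro path_join_imp) (auto simp: pathstart_def pathfinish_def pqr)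
  \<comment> \<open>Both paths run over the same time interval but at different speeds.\<close>
  then have "\<mu> (\<lambda>t. f (p t)) = \<mu> (\<lambda>t. f ((q +++ r) t))"
    by (intro maslov_index_homotopy[OF mu contf path(1)])
       (auto simp: pqr joinpaths_def algebra_simps)
  also have "\<dots> = \<mu> (\<lambda>t. f (q t)) + \<mu> (\<lambda>t. f (r t))"
    by (rule maslov_index_join[OF mu contf path(2,3)]) (simp add: pqr)
  also have "(\<lambda>t. f (r t)) = (\<lambda>t. \<Phi> (t * T) ` (\<Phi> (real m * T) ` L0))"
    by (simp only: f_def pqr per image_comp)
  finally have eq: "\<mu> (\<lambda>s. \<Phi> (s * (real (Suc m) * T)) ` L0)
      = \<mu> (\<lambda>s. \<Phi> (s * (real m * T)) ` L0) + \<mu> (\<lambda>t. \<Phi> (t * T) ` (\<Phi> (real m * T) ` L0))"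
    by (simp only: f_def pqr)
  have "\<bar>\<mu> (\<lambda>t. \<Phi> (t * T) ` (\<Phi> (real m * T) ` L0)) - \<mu> (\<lambda>t. \<Phi> (t * T) ` L0)\<bar> \<le> 2 * int n"
    using lagrangian_symplectic_image[OF \<omega> \<Phi>(1,2) L0] 
    by (rule maslov_index_change_start[OF \<omega> n L0 mu _ \<Phi> cont])
  with Suc show ?case unfolding m_def[symmetric] eq by (simp add: m_def algebra_simps)
qed simp

section \<open>Hamiltonian flows preserve closed forms\<close>

text \<open>The mean value theorem in direction u turns the second difference into s times a
  difference of \<open>fu\<close> at two points that differ by s v. Linearizing \<open>fu\<close> at
  p evaluates it as s^2 \<open>Fu v\<close> + o(s^2).\<close>

lemma second_difference_quotient_tendsto:
  fixes f :: "'a::real_normed_vector \<Rightarrow> real"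
  assumes U: "open U" "p \<in> U"
    and fu: "\<And>q. q \<in> U \<Longrightarrow> ((\<lambda>s. f (q + s *\<^sub>R u)) has_real_derivative fu q) (at 0)"
    and Fu: "(fu has_derivative Fu) (at p)"
  shows "((\<lambda>s. (f (p + s *\<^sub>R u + s *\<^sub>R v) - f (p + s *\<^sub>R u) - f (p + s *\<^sub>R v) + f p) / s\<^sup>2)
           \<longlongrightarrow> Fu v) (at_right 0)"
  unfolding tendsto_iff
proof (intro allI impI)
  fix \<epsilon> :: real assume \<epsilon>: "\<epsilon> > 0"
  \<comment> \<open>The two evaluation points A and B satisfy |A| + |B| \<le> s (2|u| + |v|); the
    summand 1 keeps K positive. The tolerance \<epsilon>/(2K) then leaves a total error of
    \<epsilon>/2.\<close>
  define K where "K = 2 * norm u + norm v + 1"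
  have K: "K > 0" by (simp add: K_def add_nonneg_pos)
  have Flin: "linear Fu" using Fu has_derivative_linear by blast
  obtain r where r: "r > 0" "ball p r \<subseteq> U" using U openE by blast
  have "\<epsilon> / (2 * K) > 0" using \<epsilon> K by simp
  then obtain d where d: "d > 0"
    "\<And>y. norm (y - p) < d \<Longrightarrow> norm (fu y - fu p - Fu (y - p)) \<le> \<epsilon> / (2 * K) * norm (y - p)"
    using Fu unfolding has_derivative_at_alt by blast
  define D where "D s = f (p + s *\<^sub>R u + s *\<^sub>R v) - f (p + s *\<^sub>R u) - f (p + s *\<^sub>R v) + f p" for s
  have "dist (D s / s\<^sup>2) (Fu v) < \<epsilon>" if s: "0 < s" "s < min d r / K" for s
  proof -
    have sK: "s * K < d" "s * K < r" using s K by (auto simp: field_simps)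
    have small: "norm (a *\<^sub>R u + c *\<^sub>R v) \<le> s * (norm u + norm v)" if "0 \<le> a" "a \<le> s" "0 \<le> c" "c \<le> s" for a c
    proof -
      have "norm (a *\<^sub>R u + c *\<^sub>R v) \<le> a * norm u + c * norm v"
        using norm_triangle_ineq[of "a *\<^sub>R u" "c *\<^sub>R v"] that by simp
      also have "\<dots> \<le> s * norm u + s * norm v" using that by (intro add_mono mult_right_mono) auto
      finally show ?thesis by (simp add: algebra_simps)
    qed
    have "s * (norm u + norm v) \<le> s * K" using s(1) by (intro mult_left_mono) (auto simp: K_def)
    then have small': "norm (a *\<^sub>R u + c *\<^sub>R v) < d" "norm (a *\<^sub>R u + c *\<^sub>R v) < r"
      if "0 \<le> a" "a \<le> s" "0 \<le> c" "c \<le> s" for a c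
      using small[OF that] sK by linarith+
    have inU: "p + a *\<^sub>R u + c *\<^sub>R v \<in> U" if "0 \<le> a" "a \<le> s" "0 \<le> c" "c \<le> s" for a c
    proof -
      have "p + (a *\<^sub>R u + c *\<^sub>R v) \<in> ball p r"
        using small'(2)[OF that] by (simp only: mem_ball dist_norm) (simp add: norm_minus_commute add.commute)
      then show ?thesis using r(2) by (auto simp: add.assoc)
    qed
    have der: "((\<lambda>a. f (q + a *\<^sub>R u)) has_real_derivative fu (q + a *\<^sub>R u)) (at a)"
      if "q + a *\<^sub>R u \<in> U" for q a
    proof -
      have "((\<lambda>h. f (q + (h + a) *\<^sub>R u)) has_real_derivative fu (q + a *\<^sub>R u)) (at 0)"
        using fu[OF that] by (simp add: algebra_simps)
      then show ?thesis using DERIV_shift[of "\<lambda>b. f (q + b *\<^sub>R u)" _ 0 a] by simp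
    qed
    have "\<exists>\<xi>>0. \<xi> < s \<and> (f (p + s *\<^sub>R v + s *\<^sub>R u) - f (p + s *\<^sub>R u)) - (f (p + s *\<^sub>R v + 0 *\<^sub>R u) - f (p + 0 *\<^sub>R u))
        = (s - 0) * (fu (p + s *\<^sub>R v + \<xi> *\<^sub>R u) - fu (p + \<xi> *\<^sub>R u))"
    proof (rule MVT2[OF s(1)])
      fix a assume a: "0 \<le> a" "a \<le> s"
      have "p + s *\<^sub>R v + a *\<^sub>R u \<in> U" "p + a *\<^sub>R u \<in> U"
        using inU[OF a, of s] inU[OF a, of 0] s(1) by (simp_all add: add_ac)
      then show "((\<lambda>a. f (p + s *\<^sub>R v + a *\<^sub>R u) - f (p + a *\<^sub>R u)) has_real_derivative
          fu (p + s *\<^sub>R v + a *\<^sub>R u) - fu (p + a *\<^sub>R u)) (at a)"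
        by (intro DERIV_diff der)
    qed
    then obtain \<xi> where \<xi>: "0 < \<xi>" "\<xi> < s" and D: "D s = s * (fu (p + s *\<^sub>R v + \<xi> *\<^sub>R u) - fu (p + \<xi> *\<^sub>R u))"
      by (auto simp: D_def add_ac)
    define A B where AB: "A = \<xi> *\<^sub>R u + s *\<^sub>R v" "B = \<xi> *\<^sub>R u"
    have "norm A < d" "norm B < d" "norm A \<le> s * (norm u + norm v)"
      using small'(1)[of \<xi> s] small'(1)[of \<xi> 0] small[of \<xi> s] \<xi> s(1) by (auto simp: AB)
    moreover have "norm B \<le> s * norm u" using \<xi> by (simp add: AB mult_right_mono)
    ultimately have nAB: "norm A < d" "norm B < d" "norm A + norm B \<le> s * K"
      using s(1) by (simp_all add: K_def algebra_simps)
    have "fu (p + A) - fu (p + B) - s * Fu v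
        = (fu (p + A) - fu p - Fu A) - (fu (p + B) - fu p - Fu B)"
      unfolding AB by (simp add: linear_add[OF Flin] linear_cmul[OF Flin])
    also have "\<bar>\<dots>\<bar> \<le> \<epsilon> / (2 * K) * norm A + \<epsilon> / (2 * K) * norm B"
      using d(2)[of "p + A"] d(2)[of "p + B"] nAB by simp
    also have "\<dots> = \<epsilon> / (2 * K) * (norm A + norm B)" by (simp only: distrib_left)
    also have "\<dots> \<le> \<epsilon> / (2 * K) * (s * K)" using nAB(3) \<epsilon> K by (intro mult_left_mono) auto
    also have "\<dots> = s * \<epsilon> / 2" using K by simp
    finally have key: "\<bar>fu (p + A) - fu (p + B) - s * Fu v\<bar> \<le> s * \<epsilon> / 2" .
    have "D s / s\<^sup>2 - Fu v = (fu (p + A) - fu (p + B) - s * Fu v) / s"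
      unfolding D AB using s(1) by (simp add: field_simps power2_eq_square)
    then have "\<bar>D s / s\<^sup>2 - Fu v\<bar> = \<bar>fu (p + A) - fu (p + B) - s * Fu v\<bar> / s"
      using s(1) by (simp add: abs_divide del: diff_divide_distrib)
    also have "\<dots> \<le> (s * \<epsilon> / 2) / s" using key s(1) by (intro divide_right_mono) auto
    finally have "\<bar>D s / s\<^sup>2 - Fu v\<bar> \<le> \<epsilon> / 2" using s(1) by simp
    then show ?thesis using \<epsilon> by (simp add: dist_real_def)
  qed
  moreover have "min d r / K > 0" using d(1) r(1) K by simp
  ultimately show "\<forall>\<^sub>F s in at_right 0. dist ((f (p + s *\<^sub>R u + s *\<^sub>R v) - f (p + s *\<^sub>R u)
      - f (p + s *\<^sub>R v) + f p) / s\<^sup>2) (Fu v) < \<epsilon>"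
    unfolding eventually_at_right_field D_def by blast
qed

text \<open>The second difference is symmetric in u and v, so both iterated derivatives are limits
  of the same quotient.\<close>

lemma directional_derivatives_commute:
  fixes f :: "'a::real_normed_vector \<Rightarrow> real"
  assumes "open U" "p \<in> U"
    and fu: "\<And>q. q \<in> U \<Longrightarrow> ((\<lambda>s. f (q + s *\<^sub>R u)) has_real_derivative fu q) (at 0)"
    and fv: "\<And>q. q \<in> U \<Longrightarrow> ((\<lambda>s. f (q + s *\<^sub>R v)) has_real_derivative fv q) (at 0)"
    and "(fu has_derivative Fu) (at p)" "(fv has_derivative Fv) (at p)"
  shows "Fu v = Fv u"
proof -
  have "((\<lambda>s. (f (p + s *\<^sub>R v + s *\<^sub>R u) - f (p + s *\<^sub>R v) - f (p + s *\<^sub>R u) + f p) / s\<^sup>2)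
           \<longlongrightarrow> Fv u) (at_right 0)"
    by (rule second_difference_quotient_tendsto[OF assms(1,2) fv assms(6)])
  then have "((\<lambda>s. (f (p + s *\<^sub>R u + s *\<^sub>R v) - f (p + s *\<^sub>R u) - f (p + s *\<^sub>R v) + f p) / s\<^sup>2)
           \<longlongrightarrow> Fv u) (at_right 0)"
    by (simp add: algebra_simps)
  then show ?thesis
    using second_difference_quotient_tendsto[OF assms(1,2) fu assms(5), of v]
    by (intro tendsto_unique) auto
qed

lemma has_derivative_directional:
  fixes g :: "'a::real_normed_vector \<Rightarrow> real"
  assumes "(g has_derivative g') (at q)"
  shows "((\<lambda>s. g (q + s *\<^sub>R e)) has_real_derivative g' e) (at 0)"
proof -
  have "((\<lambda>s. q + s *\<^sub>R e) has_derivative (\<lambda>s. s *\<^sub>R e)) (at 0)"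
    by (auto intro!: derivative_eq_intros)
  moreover have "(g has_derivative g') (at (q + 0 *\<^sub>R e))" using assms by simp
  ultimately have "((\<lambda>s. g (q + s *\<^sub>R e)) has_derivative (\<lambda>s. g' (s *\<^sub>R e))) (at 0)"
    by (rule has_derivative_compose)
  moreover have "(\<lambda>s. g' (s *\<^sub>R e)) = (*) (g' e)"
    using linear_cmul[OF has_derivative_linear[OF assms]] by (auto simp: mult.commute)
  ultimately show ?thesis by (simp add: has_field_derivative_def)
qed

text \<open>A product rule with three varying entries: base point and both arguments.
  Differentiability is given only for the coefficients on fixed vectors, so everything is expanded
  in the basis, differentiated there and reassembled.\<close>

lemma has_derivative_bilinear_form_field:
  fixes \<omega> :: "'e::euclidean_space \<Rightarrow> 'e \<Rightarrow> 'e \<Rightarrow> real" and g a b :: "'x::real_normed_vector \<Rightarrow> 'e"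
  assumes W: "open W" "\<And>x. x \<in> W \<Longrightarrow> bilinear (\<omega> x)"
    and diff: "\<And>i j. (\<lambda>x. \<omega> x i j) differentiable at (g p)"
    and U: "open U" "p \<in> U" "\<And>q. q \<in> U \<Longrightarrow> g q \<in> W"
    and g: "(g has_derivative g') (at p)" and a: "(a has_derivative a') (at p)"
    and b: "(b has_derivative b') (at p)"
  shows "((\<lambda>q. \<omega> (g q) (a q) (b q)) has_derivative
      (\<lambda>h. frechet_derivative (\<lambda>x. \<omega> x (a p) (b p)) (at (g p)) (g' h)
           + \<omega> (g p) (a' h) (b p) + \<omega> (g p) (a p) (b' h))) (at p)"
proof -
  define D where "D i j = frechet_derivative (\<lambda>x. \<omega> x i j) (at (g p))" for i j
  have D: "((\<lambda>x. \<omega> x i j) has_derivative D i j) (at (g p))" for i j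
    unfolding D_def using diff frechet_derivative_works by blast
  have gp: "g p \<in> W" using U by blast
  have "((\<lambda>x. \<Sum>i\<in>Basis. \<Sum>j\<in>Basis. \<omega> x i j * (u \<bullet> i) * (v \<bullet> j)) has_derivative
      (\<lambda>k. \<Sum>i\<in>Basis. \<Sum>j\<in>Basis. D i j k * (u \<bullet> i) * (v \<bullet> j))) (at (g p))" for u v
    by (intro has_derivative_sum has_derivative_mult_left D)
  then have "((\<lambda>x. \<omega> x u v) has_derivative
      (\<lambda>k. \<Sum>i\<in>Basis. \<Sum>j\<in>Basis. D i j k * (u \<bullet> i) * (v \<bullet> j))) (at (g p))" for u v
    using W(1) gp by (rule has_derivative_transform_within_open) (rule bilinear_basis_expansion[OF W(2), symmetric])
  then have fD: "frechet_derivative (\<lambda>x. \<omega> x u v) (at (g p))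
      = (\<lambda>k. \<Sum>i\<in>Basis. \<Sum>j\<in>Basis. D i j k * (u \<bullet> i) * (v \<bullet> j))" for u v
    by (rule frechet_derivative_at[symmetric])
  have gD: "((\<lambda>q. \<omega> (g q) i j) has_derivative (\<lambda>h. D i j (g' h))) (at p)" for i j
    using g D by (rule has_derivative_compose)
  have "((\<lambda>q. \<Sum>i\<in>Basis. \<Sum>j\<in>Basis. \<omega> (g q) i j * (a q \<bullet> i) * (b q \<bullet> j)) has_derivative
      (\<lambda>h. \<Sum>i\<in>Basis. \<Sum>j\<in>Basis. \<omega> (g p) i j * (a p \<bullet> i) * (b' h \<bullet> j) +
         (\<omega> (g p) i j * (a' h \<bullet> i) + D i j (g' h) * (a p \<bullet> i)) * (b p \<bullet> j))) (at p)"
    by (intro has_derivative_sum has_derivative_mult gD has_derivative_inner_left a b)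
  also have "(\<lambda>h. \<Sum>i\<in>Basis. \<Sum>j\<in>Basis. \<omega> (g p) i j * (a p \<bullet> i) * (b' h \<bullet> j) +
         (\<omega> (g p) i j * (a' h \<bullet> i) + D i j (g' h) * (a p \<bullet> i)) * (b p \<bullet> j))
    = (\<lambda>h. frechet_derivative (\<lambda>x. \<omega> x (a p) (b p)) (at (g p)) (g' h)
           + \<omega> (g p) (a' h) (b p) + \<omega> (g p) (a p) (b' h))"
    unfolding fD
    by (subst (3 4) bilinear_basis_expansion[OF W(2)[OF gp]])
       (simp add: sum.distrib algebra_simps)
  finally show ?thesis
    using U(1,2) by (rule has_derivative_transform_within_open) (rule bilinear_basis_expansion[OF W(2)[OF U(3)], symmetric])
qed

text \<open>In coordinates: if \<open>\<omega>(\<partial>\<^sub>t y, \<cdot>) = dh\<close>, then \<open>\<partial>\<^sub>u \<partial>\<^sub>v (h \<circ> y) = \<partial>\<^sub>v \<partial>\<^sub>u (h \<circ> y)\<close> together with \<open>d\<omega> = 0\<close>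
  says that \<open>\<omega>(\<partial>\<^sub>u y, \<partial>\<^sub>v y)\<close> does not depend on time.\<close>

lemma hamiltonian_flow_preserves_form:
  fixes y :: "real \<times> 'e::euclidean_space \<Rightarrow> 'e" and \<omega> :: "'e \<Rightarrow> 'e \<Rightarrow> 'e \<Rightarrow> real"
    and h :: "'e \<times> real \<Rightarrow> real"
  assumes U: "open U" "Ck_on (Suc (Suc 0)) U y" "\<And>q. q \<in> U \<Longrightarrow> y q \<in> W" and W: "open W"
    and bil: "\<And>x. x \<in> W \<Longrightarrow> bilinear (\<omega> x)" and anti: "\<And>x u v. x \<in> W \<Longrightarrow> \<omega> x u v = - \<omega> x v u"
    and diff: "\<And>x i j. x \<in> W \<Longrightarrow> (\<lambda>x. \<omega> x i j) differentiable at x"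
    and closed: "\<And>x u v w. x \<in> W \<Longrightarrow>
        frechet_derivative (\<lambda>x. \<omega> x v w) (at x) u +
        frechet_derivative (\<lambda>x. \<omega> x w u) (at x) v +
        frechet_derivative (\<lambda>x. \<omega> x u v) (at x) w = 0"
    and hdiff: "\<And>x t. x \<in> W \<Longrightarrow> (\<lambda>x. h (x, t)) differentiable at x"
    and ham: "\<And>q w. q \<in> U \<Longrightarrow> \<omega> (y q) (frechet_derivative y (at q) (1, 0)) w
        = frechet_derivative (\<lambda>x. h (x, fst q)) (at (y q)) w"
    and tx: "(t, x) \<in> U"
  shows "((\<lambda>s. \<omega> (y (s, x)) (frechet_derivative y (at (s, x)) (0, u))
                            (frechet_derivative y (at (s, x)) (0, v)))
           has_real_derivative 0) (at t)"
proof -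
  define Y where "Y e q = frechet_derivative y (at q) e" for e q
  define p where "p = (t, x)"
  have p: "p \<in> U" using tx by (simp add: p_def)
  have Wp: "y p \<in> W" using U(3) p by blast
  have dy: "(y has_derivative (\<lambda>e. Y e q)) (at q)" if "q \<in> U" for q
    unfolding Y_def using U(2) that by (simp add: frechet_derivative_works[symmetric])
  define D2 where "D2 e = frechet_derivative (Y e) (at p)" for e
  have D2: "(Y e has_derivative D2 e) (at p)" for e
    unfolding D2_def Y_def using U(2) p
    by (simp add: frechet_derivative_works[symmetric] del: split_paired_All)
  \<comment> \<open>The symmetry of second derivatives is available for real functions, hence the
    passage to components of y.\<close>
  have sym: "D2 e f = D2 f e" for e f
  proof (rule euclidean_eqI)
    fix b :: 'e assume "b \<in> Basis"
    have "((\<lambda>s. y (q + s *\<^sub>R e) \<bullet> b) has_real_derivative Y e q \<bullet> b) (at 0)" if "q \<in> U" for q e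
      by (rule has_derivative_directional[of "\<lambda>q. y q \<bullet> b" "\<lambda>e. Y e q \<bullet> b"])
         (intro has_derivative_inner_left dy that)
    moreover have "((\<lambda>q. Y e q \<bullet> b) has_derivative (\<lambda>f. D2 e f \<bullet> b)) (at p)" for e
      by (intro has_derivative_inner_left D2)
    ultimately show "D2 e f \<bullet> b = D2 f e \<bullet> b"
      using directional_derivatives_commute[OF U(1) p, of "\<lambda>q. y q \<bullet> b" e "\<lambda>q. Y e q \<bullet> b" f
          "\<lambda>q. Y f q \<bullet> b" "\<lambda>f. D2 e f \<bullet> b" "\<lambda>e. D2 f e \<bullet> b"] by blast
  qed
  define D\<omega> where "D\<omega> a b = frechet_derivative (\<lambda>x. \<omega> x a b) (at (y p))" for a b
  let ?t = "(1, 0) :: real \<times> 'e"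
  let ?u = "(0, u) :: real \<times> 'e"
  let ?v = "(0, v) :: real \<times> 'e"
  have form: "((\<lambda>q. \<omega> (y q) (Y e q) (Y f q)) has_derivative
      (\<lambda>k. D\<omega> (Y e p) (Y f p) (Y k p) + \<omega> (y p) (D2 e k) (Y f p) + \<omega> (y p) (Y e p) (D2 f k))) (at p)"
    for e f
    unfolding D\<omega>_def
    by (rule has_derivative_bilinear_form_field[OF W bil diff U(1) p U(3) dy[OF p] D2 D2]) (use Wp in auto)
  \<comment> \<open>The directions are spatial and leave \<open>fst q\<close> unchanged, so the
    explicit time dependence of h is never differentiated.\<close>
  have kder: "((\<lambda>s. h (y (q + s *\<^sub>R (0, w)), fst (q + s *\<^sub>R (0, w)))) has_real_derivative
      \<omega> (y q) (Y ?t q) (Y (0, w) q)) (at 0)" if q: "q \<in> U" for q w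
  proof -
    have "((\<lambda>x. h (x, fst q)) has_derivative frechet_derivative (\<lambda>x. h (x, fst q)) (at (y q))) (at (y q))"
      using hdiff U(3)[OF q] frechet_derivative_works by blast
    with dy[OF q] have "((\<lambda>q'. h (y q', fst q)) has_derivative
        (\<lambda>e. frechet_derivative (\<lambda>x. h (x, fst q)) (at (y q)) (Y e q))) (at q)"
      by (rule has_derivative_compose)
    from has_derivative_directional[OF this, of "(0, w)"] show ?thesis
      using ham[OF q] by (simp add: Y_def)
  qed
  have young: "D\<omega> (Y ?t p) (Y ?u p) (Y ?v p) + \<omega> (y p) (D2 ?t ?v) (Y ?u p) + \<omega> (y p) (Y ?t p) (D2 ?u ?v)
      = D\<omega> (Y ?t p) (Y ?v p) (Y ?u p) + \<omega> (y p) (D2 ?t ?u) (Y ?v p) + \<omega> (y p) (Y ?t p) (D2 ?v ?u)"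
    by (rule directional_derivatives_commute[OF U(1) p kder kder form form])
  \<comment> \<open>Antisymmetry passes to the derivative; it brings \<open>young\<close> into the
    cyclic form in which closedness is stated.\<close>
  have "D\<omega> a b k = - D\<omega> b a k" for a b k
  proof -
    have "((\<lambda>x. - \<omega> x b a) has_derivative (\<lambda>k. - D\<omega> b a k)) (at (y p))"
      unfolding D\<omega>_def using diff[OF Wp] by (intro has_derivative_minus) (simp add: frechet_derivative_works[symmetric])
    then have "((\<lambda>x. \<omega> x a b) has_derivative (\<lambda>k. - D\<omega> b a k)) (at (y p))"
      using W Wp by (rule has_derivative_transform_within_open) (metis anti)
    then show ?thesis using frechet_derivative_at unfolding D\<omega>_def by metis
  qed
  from this[of "Y ?v p" "Y ?t p" "Y ?u p"]
  \<comment> \<open>In \<open>young\<close> the terms with the mixed derivative in u and v cancel.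
    Closedness for the triple (v, t, u) trades the two remaining derivatives of \<omega> for the one
    in the time direction, which leaves the time derivative of \<omega>(\<open>Y ?u\<close>,
    \<open>Y ?v\<close>).\<close>
  have zero: "D\<omega> (Y ?u p) (Y ?v p) (Y ?t p) + \<omega> (y p) (D2 ?u ?t) (Y ?v p) + \<omega> (y p) (Y ?u p) (D2 ?v ?t) = 0"
    using young closed[OF Wp, of "Y ?v p" "Y ?t p" "Y ?u p", folded D\<omega>_def]
      sym[of ?u ?v] sym[of ?u ?t] sym[of ?v ?t] anti[OF Wp, of "Y ?u p" "D2 ?t ?v"] by simp
  have "((\<lambda>s. (s, x)) has_derivative (\<lambda>s. (s, 0))) (at t)"
    by (auto intro!: derivative_eq_intros)
  note der = has_derivative_compose[OF this form[of ?u ?v, unfolded p_def]]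
  define G where "G = (\<lambda>s. D\<omega> (Y ?u p) (Y ?v p) (Y (s, 0) p) + \<omega> (y p) (D2 ?u (s, 0)) (Y ?v p)
          + \<omega> (y p) (Y ?u p) (D2 ?v (s, 0)))"
  have dG: "((\<lambda>s. \<omega> (y (s, x)) (Y ?u (s, x)) (Y ?v (s, x))) has_derivative G) (at t)"
    using der by (simp add: G_def p_def)
  have "G s = s * G 1" for s using linear_cmul[OF has_derivative_linear[OF dG], of s 1] by simp
  then have "G = (*) 0" using zero by (auto simp: G_def fun_eq_iff)
  then show ?thesis using dG by (simp add: has_field_derivative_def Y_def)
qed

section \<open>Linearized Hamiltonian flows\<close>

lemma smooth_on_has_derivative:
  "smooth_on S f \<Longrightarrow> x \<in> S \<Longrightarrow> (f has_derivative frechet_derivative f (at x)) (at x)"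
  using Ck_on.simps(2)[of 0 S f] by (simp add: smooth_on_def frechet_derivative_works[symmetric] del: Ck_on.simps)

lemma smooth_on_continuous: "smooth_on S f \<Longrightarrow> continuous_on S f"
  unfolding smooth_on_def by (metis Ck_on.simps(1))

lemma smooth_on_continuous_derivative:
  "smooth_on S f \<Longrightarrow> continuous_on S (\<lambda>x. frechet_derivative f (at x) v)"
  unfolding smooth_on_def by (metis Ck_on.simps)

section \<open>Charts and changes of coordinates\<close>

locale smooth_manifold =
  fixes A :: "('m::{t2_space, second_countable_topology}, 'e::euclidean_space) chart set"
  assumes atlas: "smooth_atlas A"
begin

lemma chart_at_in: "chart_at A p \<in> A" and mem_chart_at: "p \<in> cdom (chart_at A p)"
proof -
  have "\<exists>c. c \<in> A \<and> p \<in> cdom c" using atlas unfolding smooth_atlas_def by blast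
  then have "chart_at A p \<in> A \<and> p \<in> cdom (chart_at A p)"
    unfolding chart_at_def by (rule someI_ex)
  then show "chart_at A p \<in> A" "p \<in> cdom (chart_at A p)" by auto
qed

lemma chart:
  assumes "c \<in> A"
  shows "open (cdom c)" "open (cimg c)" "continuous_on (cdom c) (cmap c)" "continuous_on (cimg c) (cinv c)"
    "\<And>p. p \<in> cdom c \<Longrightarrow> cinv c (cmap c p) = p"
  using atlas assms unfolding smooth_atlas_def homeomorphism_def by blast+

lemma cinv_in: "y \<in> cimg c \<Longrightarrow> cinv c y \<in> cdom c"
  and cmap_cinv: "y \<in> cimg c \<Longrightarrow> cmap c (cinv c y) = y"
  by (rule inv_into_into, simp) (rule f_inv_into_f, simp)

text \<open>Both \<open>from_chart\<close> and \<open>to_chart\<close> are instances, so that one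
  chain rule shows them to be inverse to each other.\<close>

definition transition_deriv :: "('m, 'e) chart \<Rightarrow> ('m, 'e) chart \<Rightarrow> 'm \<Rightarrow> 'e \<Rightarrow> 'e" where
  "transition_deriv c d p = frechet_derivative (cmap d \<circ> cinv c) (at (cmap c p))"

lemma from_chart_eq: "from_chart A c p = transition_deriv c (chart_at A p) p"
  and to_chart_eq: "to_chart A c p = transition_deriv (chart_at A p) c p"
  by (simp_all add: from_chart_def to_chart_def transition_deriv_def)

lemma has_derivative_transition:
  assumes "c \<in> A" "d \<in> A" "p \<in> cdom c" "p \<in> cdom d"
  shows "(cmap d \<circ> cinv c has_derivative transition_deriv c d p) (at (cmap c p))"
  unfolding transition_deriv_def
  by (rule smooth_on_has_derivative) (use assms atlas in \<open>auto simp: smooth_atlas_def\<close>)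

lemma linear_transition:
  assumes "c \<in> A" "d \<in> A" "p \<in> cdom c" "p \<in> cdom d"
  shows "linear (transition_deriv c d p)"
  using has_derivative_transition[OF assms] by (rule has_derivative_linear)

text \<open>The neighbourhood U keeps g inside \<open>cdom c\<close>; only there does
  \<open>cinv c\<close> undo \<open>cmap c\<close>, so that the chain rule through c gives back
  g.\<close>

lemma has_derivative_change_target:
  assumes cd: "c \<in> A" "d \<in> A" and g: "(cmap c \<circ> g has_derivative g') (at x)"
    and U: "open U" "x \<in> U" "\<And>x'. x' \<in> U \<Longrightarrow> g x' \<in> cdom c" and "g x \<in> cdom d"
  shows "(cmap d \<circ> g has_derivative transition_deriv c d (g x) \<circ> g') (at x)"
proof -
  have "(cmap d \<circ> cinv c has_derivative transition_deriv c d (g x)) (at ((cmap c \<circ> g) x))"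
    using has_derivative_transition[OF cd U(3)[OF U(2)] assms(7)] by simp
  from has_derivative_compose[OF g this]
  have "((\<lambda>x. (cmap d \<circ> cinv c) ((cmap c \<circ> g) x)) has_derivative transition_deriv c d (g x) \<circ> g') (at x)"
    by (simp add: o_def)
  then show ?thesis
    using U(1,2) by (rule has_derivative_transform_within_open) (simp add: chart(5)[OF cd(1)] U(3))
qed

lemma has_derivative_change_source:
  fixes f :: "'m \<Rightarrow> 'b::real_normed_vector"
  assumes cd: "c \<in> A" "d \<in> A" and p: "p \<in> cdom c" "p \<in> cdom d"
    and f: "(f \<circ> cinv d has_derivative f') (at (cmap d p))"
  shows "(f \<circ> cinv c has_derivative f' \<circ> transition_deriv c d p) (at (cmap c p))"
proof -
  have "(f \<circ> cinv d has_derivative f') (at ((cmap d \<circ> cinv c) (cmap c p)))"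
    using f chart(5)[OF cd(1) p(1)] by simp
  from has_derivative_compose[OF has_derivative_transition[OF cd p] this]
  have "((\<lambda>y. (f \<circ> cinv d) ((cmap d \<circ> cinv c) y)) has_derivative f' \<circ> transition_deriv c d p) (at (cmap c p))"
    by (simp add: o_def)
  moreover have "open (cimg c \<inter> cinv c -` cdom d)"
    using chart(4)[OF cd(1)] chart(2)[OF cd(1)] chart(1)[OF cd(2)] by (rule continuous_open_preimage)
  moreover have "cmap c p \<in> cimg c \<inter> cinv c -` cdom d" using p chart(5)[OF cd(1)] by simp
  ultimately show ?thesis
    by (rule has_derivative_transform_within_open) (simp add: chart(5)[OF cd(2)])
qed

lemma has_derivative_cmap_cinv:
  assumes "c \<in> A" "p \<in> cdom c"
  shows "(cmap c \<circ> cinv c has_derivative id) (at (cmap c p))"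
proof -
  have "((\<lambda>y. y) has_derivative id) (at (cmap c p))" by (simp add: id_def)
  then show ?thesis
    using chart(2)[OF assms(1)]
    by (rule has_derivative_transform_within_open) (use assms(2) cmap_cinv[of _ c] in auto)
qed

lemma transition_inverse:
  assumes "c \<in> A" "d \<in> A" "p \<in> cdom c" "p \<in> cdom d"
  shows "transition_deriv d c p (transition_deriv c d p u) = u"
proof -
  have "transition_deriv d c p \<circ> transition_deriv c d p = id"
    by (rule has_derivative_unique[OF has_derivative_change_source[OF assms] has_derivative_cmap_cinv])
       (use assms has_derivative_transition in auto)
  then show ?thesis by (simp add: fun_eq_iff)
qed

lemma from_to_chart: "c \<in> A \<Longrightarrow> p \<in> cdom c \<Longrightarrow> from_chart A c p (to_chart A c p u) = u"
  unfolding from_chart_eq to_chart_eq by (rule transition_inverse[OF chart_at_in _ mem_chart_at])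

lemma to_from_chart: "c \<in> A \<Longrightarrow> p \<in> cdom c \<Longrightarrow> to_chart A c p (from_chart A c p u) = u"
  unfolding from_chart_eq to_chart_eq by (rule transition_inverse[OF _ chart_at_in _ mem_chart_at])

lemma linear_from_chart: "c \<in> A \<Longrightarrow> p \<in> cdom c \<Longrightarrow> linear (from_chart A c p)"
  and linear_to_chart: "c \<in> A \<Longrightarrow> p \<in> cdom c \<Longrightarrow> linear (to_chart A c p)"
  unfolding from_chart_eq to_chart_eq by (auto intro!: linear_transition chart_at_in mem_chart_at)

end

section \<open>The Hamiltonian flow and its differential in coordinates\<close>

locale hamiltonian_system =
  fixes A :: "('m::{t2_space, second_countable_topology}, 'e::euclidean_space) chart set"
    and \<Omega> :: "'m \<Rightarrow> 'e \<Rightarrow> 'e \<Rightarrow> real" and H :: "'m \<times> real \<Rightarrow> real"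
    and D :: "(real \<times> 'm) set" and F :: "real \<Rightarrow> 'm \<Rightarrow> 'm"
  assumes sympl: "symplectic_manifold A \<Omega>" and ham: "smooth_hamiltonian A H"
    and flow: "maximal_flow A (hamiltonian_vf A \<Omega> H) D F"

sublocale hamiltonian_system \<subseteq> smooth_manifold A
  by unfold_locales (use sympl in \<open>simp add: symplectic_manifold_def\<close>)

context hamiltonian_system
begin

abbreviation X :: "real \<Rightarrow> 'm \<Rightarrow> 'e" where "X \<equiv> hamiltonian_vf A \<Omega> H"

lemma symplectic_form_at: "symplectic_form (\<Omega> p)"
  using sympl by (simp add: symplectic_manifold_def)

lemma hamiltonian_differentiable:
  assumes "c \<in> A" "y \<in> cimg c"
  shows "(\<lambda>y. H (cinv c y, t)) differentiable at y"
proof -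
  have "((\<lambda>y. (y, t)) has_derivative (\<lambda>h. (h, 0))) (at y)"
    by (auto intro!: derivative_eq_intros)
  moreover have "((\<lambda>(y, t). H (cinv c y, t)) has_derivative frechet_derivative (\<lambda>(y, t). H (cinv c y, t)) (at (y, t))) (at (y, t))"
    by (rule smooth_on_has_derivative[of "cimg c \<times> UNIV"])
       (use ham assms in \<open>auto simp: smooth_hamiltonian_def\<close>)
  ultimately have "((\<lambda>y. (\<lambda>(y, t). H (cinv c y, t)) (y, t)) has_derivative
      (\<lambda>h. frechet_derivative (\<lambda>(y, t). H (cinv c y, t)) (at (y, t)) (h, 0))) (at y)"
    by (rule has_derivative_compose)
  then show ?thesis unfolding differentiable_def by auto
qed

lemma hamiltonian_vf_eq:
  "\<Omega> p (X t p) v = frechet_derivative (\<lambda>y. H (cinv (chart_at A p) y, t)) (at (cmap (chart_at A p) p)) v"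
proof -
  let ?D = "frechet_derivative (\<lambda>y. H (cinv (chart_at A p) y, t)) (at (cmap (chart_at A p) p))"
  have "(\<lambda>y. H (cinv (chart_at A p) y, t)) differentiable at (cmap (chart_at A p) p)"
    by (rule hamiltonian_differentiable[OF chart_at_in]) (simp add: mem_chart_at)
  then have "linear ?D" using frechet_derivative_works has_derivative_linear by blast
  from theI'[OF symplectic_form_represents[OF symplectic_form_at this]]
  show ?thesis unfolding hamiltonian_vf_def by blast
qed

lemma form_in_chart_eq:
  assumes "c \<in> A" "p \<in> cdom c"
  shows "form_in_chart A \<Omega> c (cmap c p) u v = \<Omega> p (from_chart A c p u) (from_chart A c p v)"
  using chart(5)[OF assms] by (simp add: form_in_chart_def)

text \<open>The vector field is defined with the chart chosen at p. Its defining equation holds in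
  every chart because both sides transform by the same \<open>from_chart\<close>.\<close>

lemma hamiltonian_vf_in_chart:
  assumes c: "c \<in> A" "p \<in> cdom c"
  shows "form_in_chart A \<Omega> c (cmap c p) (to_chart A c p (X t p)) w
    = frechet_derivative (\<lambda>y. H (cinv c y, t)) (at (cmap c p)) w"
proof -
  let ?d = "chart_at A p"
  let ?D = "frechet_derivative (\<lambda>y. H (cinv ?d y, t)) (at (cmap ?d p))"
  have "(\<lambda>y. H (cinv ?d y, t)) differentiable at (cmap ?d p)"
    by (rule hamiltonian_differentiable[OF chart_at_in]) (simp add: mem_chart_at)
  then have "((\<lambda>p. H (p, t)) \<circ> cinv ?d has_derivative ?D) (at (cmap ?d p))"
    by (simp add: frechet_derivative_works o_def)
  from has_derivative_change_source[OF c(1) chart_at_in c(2) mem_chart_at this]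
  have "((\<lambda>y. H (cinv c y, t)) has_derivative ?D \<circ> from_chart A c p) (at (cmap c p))"
    by (simp add: from_chart_eq o_def)
  then have "frechet_derivative (\<lambda>y. H (cinv c y, t)) (at (cmap c p)) = ?D \<circ> from_chart A c p"
    by (rule frechet_derivative_at[symmetric])
  then show ?thesis
    by (simp add: form_in_chart_eq[OF c] from_to_chart[OF c] hamiltonian_vf_eq)
qed

lemma bilinear_form_in_chart:
  assumes "c \<in> A" "y \<in> cimg c"
  shows "bilinear (form_in_chart A \<Omega> c y)"
proof -
  have l: "linear (from_chart A c (cinv c y))"
    using assms(1) cinv_in[OF assms(2)] by (rule linear_from_chart)
  note b = symplectic_form_bilinear[OF symplectic_form_at, of "cinv c y"]
  show ?thesis
    unfolding bilinear_def form_in_chart_def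
    by (auto intro!: linearI simp: linear_add[OF l] linear_cmul[OF l] bilinear_ladd[OF b] bilinear_radd[OF b]
        bilinear_lmul[OF b] bilinear_rmul[OF b])
qed

lemma D_open: "open D"
  and D_zero: "(0, x) \<in> D" and F_zero: "F 0 x = x"
  and D_interval: "is_interval {t. (t, x) \<in> D}"
  and F_curve: "integral_curve_on A X {t. (t, x) \<in> D} (\<lambda>t. F t x)"
  and F_cont: "continuous_on D (\<lambda>(t, x). F t x)"
  using flow unfolding maximal_flow_def by blast+

lemma flow_maximal:
  assumes "is_interval I" "0 \<in> I" "integral_curve_on A X I \<gamma>" "t \<in> I"
  shows "(t, \<gamma> 0) \<in> D" "F t (\<gamma> 0) = \<gamma> t"
  using flow assms unfolding maximal_flow_def by blast+

lemma open_flow_times: "open {t. (t, x) \<in> D}"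
proof -
  have "open ((\<lambda>t. (t, x)) -` D)" by (intro open_vimage D_open continuous_intros)
  then show ?thesis by (simp add: vimage_def)
qed

definition flow_dom :: "('m, 'e) chart \<Rightarrow> ('m, 'e) chart \<Rightarrow> (real \<times> 'e) set" where
  "flow_dom c d = {(t, y). y \<in> cimg c \<and> (t, cinv c y) \<in> D \<and> F t (cinv c y) \<in> cdom d}"

definition flow_rep :: "('m, 'e) chart \<Rightarrow> ('m, 'e) chart \<Rightarrow> real \<times> 'e \<Rightarrow> 'e" where
  "flow_rep c d = (\<lambda>(t, y). cmap d (F t (cinv c y)))"

lemma smooth_flow_rep: "c \<in> A \<Longrightarrow> d \<in> A \<Longrightarrow> smooth_on (flow_dom c d) (flow_rep c d)"
  using flow unfolding maximal_flow_def flow_dom_def flow_rep_def by blast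

lemma open_chart_domain:
  assumes "c \<in> A"
  shows "open {(t, y). y \<in> cimg c \<and> (t, cinv c y) \<in> D}"
    and "continuous_on {(t, y). y \<in> cimg c \<and> (t, cinv c y) \<in> D} (\<lambda>(t, y). F t (cinv c y))"
proof -
  have "continuous_on (UNIV \<times> cimg c) (\<lambda>q. cinv c (snd q))"
    by (rule continuous_on_compose2[OF chart(4)[OF assms]]) (auto intro!: continuous_intros)
  then have cont: "continuous_on (UNIV \<times> cimg c) (\<lambda>q :: real \<times> 'e. (fst q, cinv c (snd q)))"
    by (intro continuous_intros)
  have eq: "{(t, y). y \<in> cimg c \<and> (t, cinv c y) \<in> D}
      = (UNIV \<times> cimg c) \<inter> (\<lambda>q. (fst q, cinv c (snd q))) -` D" by auto
  show "open {(t, y). y \<in> cimg c \<and> (t, cinv c y) \<in> D}"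
    unfolding eq using cont by (rule continuous_open_preimage) (use chart(2)[OF assms] D_open in \<open>auto intro: open_Times\<close>)
  have "continuous_on {(t, y). y \<in> cimg c \<and> (t, cinv c y) \<in> D} (\<lambda>q. (\<lambda>(t, x). F t x) (fst q, cinv c (snd q)))"
    by (rule continuous_on_compose2[OF F_cont continuous_on_subset[OF cont]]) auto
  then show "continuous_on {(t, y). y \<in> cimg c \<and> (t, cinv c y) \<in> D} (\<lambda>(t, y). F t (cinv c y))"
    by (simp add: case_prod_unfold)
qed

lemma open_flow_dom:
  assumes "c \<in> A" "d \<in> A"
  shows "open (flow_dom c d)"
proof -
  have "flow_dom c d = {(t, y). y \<in> cimg c \<and> (t, cinv c y) \<in> D} \<inter> (\<lambda>(t, y). F t (cinv c y)) -` cdom d"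
    by (auto simp: flow_dom_def)
  then show ?thesis
    using continuous_open_preimage[OF open_chart_domain(2,1)[OF assms(1)] chart(1)[OF assms(2)]] by simp
qed

lemma mem_flow_dom:
  assumes "c \<in> A" "x \<in> cdom c" "(t, x) \<in> D" "F t x \<in> cdom d"
  shows "(t, cmap c x) \<in> flow_dom c d"
  using assms chart(5)[OF assms(1,2)] by (auto simp: flow_dom_def)

lemma flow_time_derivative:
  assumes "(t, x) \<in> D" "d \<in> A" "F t x \<in> cdom d"
  shows "(cmap d \<circ> (\<lambda>s. F s x) has_derivative (\<lambda>h. h *\<^sub>R to_chart A d (F t x) (X t (F t x)))) (at t)"
proof -
  let ?J = "{t. (t, x) \<in> D}" and ?p = "F t x"
  have "(cmap (chart_at A ?p) \<circ> (\<lambda>s. F s x) has_vector_derivative X t ?p) (at t within ?J)"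
    and cont: "continuous_on ?J (\<lambda>s. F s x)"
    using F_curve assms(1) unfolding integral_curve_on_def by blast+
  \<comment> \<open>The time domain is open, so the one-sided derivatives in
    \<open>integral_curve_on\<close> are two-sided.\<close>
  then have der: "(cmap (chart_at A ?p) \<circ> (\<lambda>s. F s x) has_derivative (\<lambda>h. h *\<^sub>R X t ?p)) (at t)"
    using has_vector_derivative_within_open[OF _ open_flow_times] assms(1)
    unfolding has_vector_derivative_def by blast
  have "open (?J \<inter> (\<lambda>s. F s x) -` cdom (chart_at A ?p))"
    by (rule continuous_open_preimage[OF cont open_flow_times chart(1)[OF chart_at_in]])
  from has_derivative_change_target[OF chart_at_in assms(2) der this] assms mem_chart_at[of ?p]
  have "(cmap d \<circ> (\<lambda>s. F s x) has_derivative to_chart A d ?p \<circ> (\<lambda>h. h *\<^sub>R X t ?p)) (at t)"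
    by (simp add: to_chart_eq)
  then show ?thesis
    using linear_cmul[OF linear_to_chart[OF assms(2,3)]] by (simp add: o_def)
qed

lemma flow_rep_time_derivative:
  assumes "c \<in> A" "d \<in> A" "q \<in> flow_dom c d"
  shows "frechet_derivative (flow_rep c d) (at q) (1, 0)
    = to_chart A d (F (fst q) (cinv c (snd q))) (X (fst q) (F (fst q) (cinv c (snd q))))"
proof -
  obtain t y where q: "q = (t, y)" by (cases q)
  have ty: "y \<in> cimg c" "(t, cinv c y) \<in> D" "F t (cinv c y) \<in> cdom d"
    using assms(3) by (auto simp: flow_dom_def q)
  have "((\<lambda>s. (s, y)) has_derivative (\<lambda>s. (s, 0))) (at t)" by (auto intro!: derivative_eq_intros)
  from has_derivative_compose[OF this smooth_on_has_derivative[OF smooth_flow_rep[OF assms(1,2)] assms(3)[unfolded q]]]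
  have "(cmap d \<circ> (\<lambda>s. F s (cinv c y)) has_derivative
      (\<lambda>s. frechet_derivative (flow_rep c d) (at (t, y)) (s, 0))) (at t)"
    by (simp add: flow_rep_def o_def)
  from has_derivative_unique[OF this flow_time_derivative[OF ty(2) assms(2) ty(3)]]
  have "frechet_derivative (flow_rep c d) (at (t, y)) (1, 0)
      = 1 *\<^sub>R to_chart A d (F t (cinv c y)) (X t (F t (cinv c y)))" by (rule fun_cong)
  then show ?thesis by (simp add: q)
qed

lemma flow_space_derivative:
  assumes "c \<in> A" "d \<in> A" "(t, y) \<in> flow_dom c d"
  shows "(cmap d \<circ> F t \<circ> cinv c has_derivative (\<lambda>e. frechet_derivative (flow_rep c d) (at (t, y)) (0, e))) (at y)"
proof -
  have "((\<lambda>y. (t, y)) has_derivative (\<lambda>e. (0, e))) (at y)" by (auto intro!: derivative_eq_intros)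
  from has_derivative_compose[OF this smooth_on_has_derivative[OF smooth_flow_rep[OF assms(1,2)] assms(3)]]
  show ?thesis by (simp add: flow_rep_def o_def)
qed

text \<open>\<open>tangent_map\<close> is written in the chart at \<open>F t x\<close>, which may
  jump as t varies. Here d can stay fixed, and the derivative of the smooth \<open>flow_rep\<close>
  depends continuously on t.\<close>

lemma tangent_map_in_chart:
  assumes "(t, x) \<in> D" "d \<in> A" "F t x \<in> cdom d"
  shows "tangent_map A (F t) x e = from_chart A d (F t x)
    (frechet_derivative (flow_rep (chart_at A x) d) (at (t, cmap (chart_at A x) x)) (0, e))"
proof -
  let ?c = "chart_at A x"
  let ?y = "cmap ?c x"
  have mem: "(t, ?y) \<in> flow_dom ?c d" by (rule mem_flow_dom[OF chart_at_in mem_chart_at assms(1,3)])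
  have inv: "cinv ?c ?y = x" by (rule chart(5)[OF chart_at_in mem_chart_at])
  have "open (Pair t -` flow_dom ?c d)"
    by (intro open_vimage open_flow_dom chart_at_in assms continuous_intros)
  moreover have "(cmap d \<circ> (F t \<circ> cinv ?c) has_derivative
      (\<lambda>e. frechet_derivative (flow_rep ?c d) (at (t, ?y)) (0, e))) (at ?y)"
    using flow_space_derivative[OF chart_at_in assms(2) mem] by (simp add: o_assoc)
  ultimately have "(cmap (chart_at A (F t x)) \<circ> (F t \<circ> cinv ?c) has_derivative
      transition_deriv d (chart_at A (F t x)) ((F t \<circ> cinv ?c) ?y) \<circ>
      (\<lambda>e. frechet_derivative (flow_rep ?c d) (at (t, ?y)) (0, e))) (at ?y)"
    by (intro has_derivative_change_target[of d "chart_at A (F t x)", OF assms(2) chart_at_in])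
       (use mem inv mem_chart_at in \<open>auto simp: flow_dom_def\<close>)
  from frechet_derivative_at[OF this] show ?thesis
    by (simp add: tangent_map_def from_chart_eq inv o_assoc fun_eq_iff)
qed

lemma has_derivative_tangent_map:
  assumes "(t, x) \<in> D"
  shows "(cmap (chart_at A (F t x)) \<circ> F t \<circ> cinv (chart_at A x) has_derivative tangent_map A (F t) x)
    (at (cmap (chart_at A x) x))"
proof -
  have "(t, cmap (chart_at A x) x) \<in> flow_dom (chart_at A x) (chart_at A (F t x))"
    by (rule mem_flow_dom[OF chart_at_in mem_chart_at assms mem_chart_at])
  note der = flow_space_derivative[OF chart_at_in chart_at_in this]
  show ?thesis
    unfolding tangent_map_def frechet_derivative_at[OF der, symmetric] by (rule der)
qed

lemma linear_tangent_map: "(t, x) \<in> D \<Longrightarrow> linear (tangent_map A (F t) x)"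
  by (rule has_derivative_linear[OF has_derivative_tangent_map])

lemma tangent_map_zero: "tangent_map A (F 0) x = id"
proof -
  have "F 0 = id" using F_zero by auto
  then have "(cmap (chart_at A x) \<circ> cinv (chart_at A x) has_derivative tangent_map A (F 0) x)
      (at (cmap (chart_at A x) x))"
    using has_derivative_tangent_map[OF D_zero, of x] by simp
  then show ?thesis
    using has_derivative_cmap_cinv[OF chart_at_in mem_chart_at] by (rule has_derivative_unique)
qed

text \<open>The vector w is left free for two uses: with w in the image of the tangent map it gives
  invariance of the form, with w from the trivialization it gives continuity of the fundamental
  solution.\<close>

lemma form_in_chart_flow:
  assumes "(t, x) \<in> D" "d \<in> A" "F t x \<in> cdom d"
  shows "\<Omega> (F t x) (tangent_map A (F t) x u) w
    = form_in_chart A \<Omega> d (flow_rep (chart_at A x) d (t, cmap (chart_at A x) x))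
        (frechet_derivative (flow_rep (chart_at A x) d) (at (t, cmap (chart_at A x) x)) (0, u))
        (to_chart A d (F t x) w)"
proof -
  have "flow_rep (chart_at A x) d (t, cmap (chart_at A x) x) = cmap d (F t x)"
    using chart(5)[OF chart_at_in mem_chart_at] by (simp add: flow_rep_def)
  then show ?thesis
    by (simp add: form_in_chart_eq[OF assms(2,3)] from_to_chart[OF assms(2,3)] tangent_map_in_chart[OF assms])
qed

text \<open>The claim is local in time, so the target chart is frozen at \<open>F t x\<close>. For s
  near t the coordinate expression agrees with the intrinsic pairing, and the computation in
  coordinates applies with the Hamiltonian read in that chart.\<close>

lemma pullback_form_derivative:
  assumes t: "(t, x) \<in> D"
  shows "((\<lambda>s. \<Omega> (F s x) (tangent_map A (F s) x u) (tangent_map A (F s) x v)) has_real_derivative 0) (at t)"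
proof -
  let ?c = "chart_at A x" and ?d = "chart_at A (F t x)"
  let ?y = "cmap ?c x" and ?U = "flow_dom ?c ?d" and ?f = "flow_rep ?c ?d"
  have mem: "(t, ?y) \<in> ?U" by (rule mem_flow_dom[OF chart_at_in mem_chart_at t mem_chart_at])
  have inv: "cinv ?c ?y = x" by (rule chart(5)[OF chart_at_in mem_chart_at])
  have "((\<lambda>s. form_in_chart A \<Omega> ?d (?f (s, ?y)) (frechet_derivative ?f (at (s, ?y)) (0, u))
      (frechet_derivative ?f (at (s, ?y)) (0, v))) has_real_derivative 0) (at t)"
  proof (rule hamiltonian_flow_preserves_form[where U = ?U and W = "cimg ?d" and
        h = "\<lambda>(y, t). H (cinv ?d y, t)"])
    show "open ?U" "open (cimg ?d)" by (rule open_flow_dom chart chart_at_in)+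
    show "Ck_on (Suc (Suc 0)) ?U ?f"
      using smooth_flow_rep[OF chart_at_in chart_at_in] unfolding smooth_on_def by blast
    show "?f q \<in> cimg ?d" if "q \<in> ?U" for q using that by (auto simp: flow_dom_def flow_rep_def)
    show "bilinear (form_in_chart A \<Omega> ?d y)" if "y \<in> cimg ?d" for y
      by (rule bilinear_form_in_chart[OF chart_at_in that])
    show "form_in_chart A \<Omega> ?d y u v = - form_in_chart A \<Omega> ?d y v u" for y u v
      unfolding form_in_chart_def by (rule symplectic_form_antisym[OF symplectic_form_at])
    show "(\<lambda>y. form_in_chart A \<Omega> ?d y i j) differentiable at y" if "y \<in> cimg ?d" for y i j
      using sympl chart_at_in smooth_on_has_derivative[OF _ that, of "\<lambda>y. form_in_chart A \<Omega> ?d y i j"]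
      unfolding symplectic_manifold_def differentiable_def by blast
    show "frechet_derivative (\<lambda>x. form_in_chart A \<Omega> ?d x v w) (at y) u +
        frechet_derivative (\<lambda>x. form_in_chart A \<Omega> ?d x w u) (at y) v +
        frechet_derivative (\<lambda>x. form_in_chart A \<Omega> ?d x u v) (at y) w = 0"
      if "y \<in> cimg ?d" for y u v w
      using sympl that chart_at_in unfolding symplectic_manifold_def by blast
    show "(\<lambda>x. (\<lambda>(y, t). H (cinv ?d y, t)) (x, t)) differentiable at y" if "y \<in> cimg ?d" for y t
      using hamiltonian_differentiable[OF chart_at_in that] by simp
    show "form_in_chart A \<Omega> ?d (?f q) (frechet_derivative ?f (at q) (1, 0)) w
        = frechet_derivative (\<lambda>x. (\<lambda>(y, t). H (cinv ?d y, t)) (x, fst q)) (at (?f q)) w"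
      if q: "q \<in> ?U" for q w
    proof -
      have m: "F (fst q) (cinv ?c (snd q)) \<in> cdom ?d" using q by (auto simp: flow_dom_def)
      have "?f q = cmap ?d (F (fst q) (cinv ?c (snd q)))" by (simp add: flow_rep_def case_prod_unfold)
      then show ?thesis
        using hamiltonian_vf_in_chart[OF chart_at_in m, of "fst q" w]
        by (simp add: flow_rep_time_derivative[OF chart_at_in chart_at_in q])
    qed
    show "(t, ?y) \<in> ?U" by (rule mem)
  qed
  moreover have "open ((\<lambda>s. (s, ?y)) -` ?U)"
    by (intro open_vimage open_flow_dom chart_at_in continuous_intros)
  moreover have "form_in_chart A \<Omega> ?d (?f (s, ?y)) (frechet_derivative ?f (at (s, ?y)) (0, u))
        (frechet_derivative ?f (at (s, ?y)) (0, v))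
      = \<Omega> (F s x) (tangent_map A (F s) x u) (tangent_map A (F s) x v)"
    if "s \<in> (\<lambda>s. (s, ?y)) -` ?U" for s
  proof -
    have s: "(s, x) \<in> D" "F s x \<in> cdom ?d" using that inv by (auto simp: flow_dom_def)
    show ?thesis
      using form_in_chart_flow[OF s(1) chart_at_in s(2), of u "tangent_map A (F s) x v"]
        tangent_map_in_chart[OF s(1) chart_at_in s(2), of v] to_from_chart[OF chart_at_in s(2)] by simp
  qed
  ultimately show ?thesis
    using mem unfolding has_field_derivative_def
    by (elim has_derivative_transform_within_open) auto
qed

lemma flow_symplectic:
  assumes "\<And>t. (t, x) \<in> D"
  shows "\<Omega> (F t x) (tangent_map A (F t) x u) (tangent_map A (F t) x v) = \<Omega> x u v"
  using DERIV_isconst_all[of "\<lambda>s. \<Omega> (F s x) (tangent_map A (F s) x u) (tangent_map A (F s) x v)" t 0]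
    pullback_form_derivative[OF assms] by (simp add: F_zero tangent_map_zero)

text \<open>Since \<sigma> is a period of the field, the shifted curve t \<mapsto>
  \<open>F (t + \<sigma>) x\<close> is again an integral curve; it starts at
  \<open>F \<sigma> x\<close>, and maximality of the flow identifies it.\<close>

lemma flow_shift:
  assumes per: "\<And>t. X (t + \<sigma>) = X t" and \<sigma>: "(\<sigma>, x) \<in> D" and s: "(s + \<sigma>, x) \<in> D"
  shows "(s, F \<sigma> x) \<in> D" "F s (F \<sigma> x) = F (s + \<sigma>) x"
proof -
  let ?J = "{t. (t, x) \<in> D}" and ?I = "{t. (t + \<sigma>, x) \<in> D}"
  define \<gamma> where "\<gamma> = (\<lambda>t. F (t + \<sigma>) x)"
  have int: "is_interval ?I"
    unfolding is_interval_1
  proof (intro ballI allI impI)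
    fix a b t assume "a \<in> ?I" "b \<in> ?I" "a \<le> t \<and> t \<le> b"
    then have "a + \<sigma> \<in> ?J" "b + \<sigma> \<in> ?J" "a + \<sigma> \<le> t + \<sigma>" "t + \<sigma> \<le> b + \<sigma>" by simp_all
    then have "t + \<sigma> \<in> ?J" by (rule mem_is_interval_1_I[OF D_interval])
    then show "t \<in> ?I" by simp
  qed
  have cont: "continuous_on ?J (\<lambda>s. F s x)"
    and der: "\<And>t. t \<in> ?J \<Longrightarrow> (cmap (chart_at A (F t x)) \<circ> (\<lambda>s. F s x) has_vector_derivative X t (F t x)) (at t within ?J)"
    using F_curve unfolding integral_curve_on_def by blast+
  have "integral_curve_on A X ?I \<gamma>"
    unfolding integral_curve_on_def
  proof (intro conjI ballI)
    show "continuous_on ?I \<gamma>"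
      unfolding \<gamma>_def by (rule continuous_on_compose2[OF cont]) (auto intro!: continuous_intros)
    fix t assume t: "t \<in> ?I"
    then have tJ: "t + \<sigma> \<in> ?J" by simp
    from der[OF tJ] have "(cmap (chart_at A (\<gamma> t)) \<circ> (\<lambda>s. F s x) has_vector_derivative X t (\<gamma> t)) (at (t + \<sigma>))"
      unfolding has_vector_derivative_within_open[OF tJ open_flow_times] \<gamma>_def per .
    moreover have "((\<lambda>t. t + \<sigma>) has_vector_derivative 1) (at t)"
      by (auto intro!: derivative_eq_intros)
    ultimately have "((cmap (chart_at A (\<gamma> t)) \<circ> (\<lambda>s. F s x)) \<circ> (\<lambda>t. t + \<sigma>) has_vector_derivative 1 *\<^sub>R X t (\<gamma> t)) (at t)"
      by (intro vector_diff_chain_at)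
    then have "(cmap (chart_at A (\<gamma> t)) \<circ> \<gamma> has_vector_derivative X t (\<gamma> t)) (at t)"
      by (simp add: o_def \<gamma>_def)
    then show "(cmap (chart_at A (\<gamma> t)) \<circ> \<gamma> has_vector_derivative X t (\<gamma> t)) (at t within ?I)"
      by (rule has_vector_derivative_at_within)
  qed
  from flow_maximal[OF int _ this, of s] \<sigma> s show "(s, F \<sigma> x) \<in> D" "F s (F \<sigma> x) = F (s + \<sigma>) x"
    by (auto simp: \<gamma>_def)
qed

text \<open>To be differentiated, the composition law of the flow is needed on a neighbourhood of x;
  the open flow domains for the times \<sigma> and s + \<sigma> provide one.\<close>

lemma tangent_map_shift:
  assumes per: "\<And>t. X (t + \<sigma>) = X t" and \<sigma>: "(\<sigma>, x) \<in> D" and s: "(s + \<sigma>, x) \<in> D"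
  shows "tangent_map A (F (s + \<sigma>)) x = tangent_map A (F s) (F \<sigma> x) \<circ> tangent_map A (F \<sigma>) x"
proof -
  let ?c = "chart_at A x" and ?d = "chart_at A (F \<sigma> x)" and ?e = "chart_at A (F (s + \<sigma>) x)"
  let ?y = "cmap ?c x"
  have inv: "cinv ?c ?y = x" by (rule chart(5)[OF chart_at_in mem_chart_at])
  note shift = flow_shift[OF per \<sigma> s]
  have "(cmap ?e \<circ> F s \<circ> cinv ?d has_derivative tangent_map A (F s) (F \<sigma> x))
      (at ((cmap ?d \<circ> F \<sigma> \<circ> cinv ?c) ?y))"
    using has_derivative_tangent_map[OF shift(1)] by (simp add: shift(2) inv)
  from has_derivative_compose[OF has_derivative_tangent_map[OF \<sigma>] this]
  have "((\<lambda>y. (cmap ?e \<circ> F s \<circ> cinv ?d) ((cmap ?d \<circ> F \<sigma> \<circ> cinv ?c) y)) has_derivative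
      tangent_map A (F s) (F \<sigma> x) \<circ> tangent_map A (F \<sigma>) x) (at ?y)" by (simp add: o_def)
  moreover have "open (Pair \<sigma> -` flow_dom ?c ?d \<inter> Pair (s + \<sigma>) -` flow_dom ?c ?e)"
    by (intro open_Int open_vimage open_flow_dom chart_at_in continuous_intros)
  moreover have "?y \<in> Pair \<sigma> -` flow_dom ?c ?d \<inter> Pair (s + \<sigma>) -` flow_dom ?c ?e"
    using mem_flow_dom[OF chart_at_in mem_chart_at \<sigma> mem_chart_at]
      mem_flow_dom[OF chart_at_in mem_chart_at s mem_chart_at] by simp
  ultimately have "(cmap ?e \<circ> F (s + \<sigma>) \<circ> cinv ?c has_derivative
      tangent_map A (F s) (F \<sigma> x) \<circ> tangent_map A (F \<sigma>) x) (at ?y)"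
  proof (rule has_derivative_transform_within_open)
    fix y assume "y \<in> Pair \<sigma> -` flow_dom ?c ?d \<inter> Pair (s + \<sigma>) -` flow_dom ?c ?e"
    then have y: "(\<sigma>, cinv ?c y) \<in> D" "(s + \<sigma>, cinv ?c y) \<in> D" "F \<sigma> (cinv ?c y) \<in> cdom ?d"
      by (auto simp: flow_dom_def)
    show "(cmap ?e \<circ> F s \<circ> cinv ?d) ((cmap ?d \<circ> F \<sigma> \<circ> cinv ?c) y) = (cmap ?e \<circ> F (s + \<sigma>) \<circ> cinv ?c) y"
      using flow_shift(2)[OF per y(1,2)] chart(5)[OF chart_at_in y(3)] by simp
  qed
  from has_derivative_unique[OF has_derivative_tangent_map[OF s] this] show ?thesis .
qed

end

section \<open>The periodic orbit and its fundamental solution\<close>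

lemma periodic_ext_shift:
  assumes "T \<noteq> 0"
  shows "periodic_ext T f (t + T) = periodic_ext T f t"
proof -
  have "(t + T) / T = t / T + 1" using assms by (simp add: field_simps)
  then show ?thesis by (simp add: periodic_ext_def algebra_simps)
qed

lemma periodic_ext_argument:
  fixes T :: real
  assumes "T > 0"
  shows "t - T * of_int \<lfloor>t / T\<rfloor> \<in> {0..T}"
  using floor_divide_lower[OF assms, of t] floor_divide_upper[OF assms, of t]
  by (simp add: algebra_simps)

lemma hamiltonian_vf_periodic:
  assumes "\<forall>p t. H (p, t + T) = H (p, t)"
  shows "hamiltonian_vf A \<Omega> H (t + T) = hamiltonian_vf A \<Omega> H t"
  using assms by (simp add: hamiltonian_vf_def fun_eq_iff)

locale periodic_orbit = hamiltonian_system A \<Omega> H D F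
  for A :: "('m::{t2_space, second_countable_topology}, 'e::euclidean_space) chart set"
    and \<Omega> H D F +
  fixes T :: real and z :: "real \<Rightarrow> 'm" and \<psi> :: "real \<Rightarrow> 'e \<Rightarrow> 'e"
  assumes T: "T > 0" and H_per: "\<forall>p t. H (p, t + T) = H (p, t)"
    and orbit: "integral_curve_on A X {0..T} z" and closed: "z 0 = z T"
    and triv: "periodic_symplectic_trivialization A \<Omega> T z \<psi>"
begin

lemma X_periodic: "X (t + T) = X t" "X (t + - T) = X t"
  using hamiltonian_vf_periodic[OF H_per, of A \<Omega> t] hamiltonian_vf_periodic[OF H_per, of A \<Omega> "t - T"] by simp_all

lemma orbit_flow: "t \<in> {0..T} \<Longrightarrow> (t, z 0) \<in> D" "t \<in> {0..T} \<Longrightarrow> F t (z 0) = z t"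
  using flow_maximal[OF is_interval_cc _ orbit, of t] T by simp_all

lemma orbit_shift_back:
  assumes "(t + T, z 0) \<in> D"
  shows "(t, z 0) \<in> D" "F t (z 0) = F (t + T) (z 0)"
proof -
  have T': "(T, z 0) \<in> D" "F T (z 0) = z 0" using orbit_flow[of T] T closed by auto
  show "(t, z 0) \<in> D" "F t (z 0) = F (t + T) (z 0)"
    using flow_shift[OF X_periodic(1) T'(1) assms] by (simp_all add: T'(2))
qed

text \<open>This is the shift by the period -T. It requires the time -T to lie in the domain, which
  follows by shifting back from time 0.\<close>

lemma orbit_shift: "(t, z 0) \<in> D \<Longrightarrow> (t + T, z 0) \<in> D"
proof -
  assume t: "(t, z 0) \<in> D"
  have m: "(- T, z 0) \<in> D" "F (- T) (z 0) = z 0"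
    using orbit_shift_back[of "- T"] D_zero F_zero by auto
  show "(t + T, z 0) \<in> D"
    using flow_shift(1)[OF X_periodic(2) m(1), of "t + T"] t by (simp add: m(2))
qed

text \<open>The time domain is an interval containing every integer multiple of T.\<close>

lemma orbit_all_times: "(t, z 0) \<in> D"
proof -
  have pos: "(real k * T, z 0) \<in> D" for k
  proof (induction k)
    case (Suc k)
    then show ?case using orbit_shift[of "real k * T"] by (simp add: algebra_simps)
  qed (simp add: D_zero)
  have neg: "(- (real k * T), z 0) \<in> D" for k
  proof (induction k)
    case (Suc k)
    then show ?case using orbit_shift_back(1)[of "- (real (Suc k) * T)"] by (simp add: algebra_simps)
  qed (simp add: D_zero)
  obtain k where k: "\<bar>t\<bar> < real k * T" using reals_Archimedean3[OF T] by blast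
  have "t \<in> {t. (t, z 0) \<in> D}"
    by (rule mem_is_interval_1_I[OF D_interval, of "- (real k * T)" _ "real k * T"]) (use pos neg k in auto)
  then show ?thesis by simp
qed

lemma orbit_periodic: "F (t + of_int k * T) (z 0) = F t (z 0)"
proof -
  have nat: "F (t + real j * T) (z 0) = F t (z 0)" for j t
  proof (induction j)
    case (Suc j)
    then show ?case
      using orbit_shift_back(2)[of "t + real j * T", OF orbit_all_times] by (simp add: algebra_simps)
  qed simp
  show ?thesis
  proof (cases "0 \<le> k")
    case True
    then show ?thesis using nat[of t "nat k"] by simp
  next
    case False
    then show ?thesis using nat[of "t + of_int k * T" "nat (- k)"] by simp
  qed
qed

text \<open>Smoothness of the trivialization is stated along the periodic extension of z; this makes
  it usable along the flow.\<close>

lemma periodic_ext_orbit: "periodic_ext T z t = F t (z 0)"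
proof -
  define \<tau> where "\<tau> = t - T * of_int \<lfloor>t / T\<rfloor>"
  have "\<tau> \<in> {0..T}" unfolding \<tau>_def by (rule periodic_ext_argument[OF T])
  then have "periodic_ext T z t = F \<tau> (z 0)" by (simp add: periodic_ext_def \<tau>_def orbit_flow(2))
  then show ?thesis using orbit_periodic[of t "- \<lfloor>t / T\<rfloor>"] by (simp add: \<tau>_def mult.commute)
qed

lemma trivialization:
  shows "linear (periodic_ext T \<psi> t)" "bij (periodic_ext T \<psi> t)"
    "\<Omega> (F t (z 0)) (periodic_ext T \<psi> t u) (periodic_ext T \<psi> t v) = \<Omega> (z 0) u v"
    "periodic_ext T \<psi> 0 = id" "periodic_ext T \<psi> T = id"
proof -
  define \<tau> where "\<tau> = t - T * of_int \<lfloor>t / T\<rfloor>"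
  have \<tau>: "\<tau> \<in> {0..T}" "periodic_ext T \<psi> t = \<psi> \<tau>" "periodic_ext T z t = z \<tau>"
    unfolding \<tau>_def by (rule periodic_ext_argument[OF T]) (simp_all add: periodic_ext_def)
  have \<psi>: "linear (\<psi> \<tau>)" "bij (\<psi> \<tau>)" "\<Omega> (z \<tau>) (\<psi> \<tau> u) (\<psi> \<tau> v) = \<Omega> (z 0) u v" for u v
    using triv \<tau>(1) unfolding periodic_symplectic_trivialization_def by blast+
  show "linear (periodic_ext T \<psi> t)" "bij (periodic_ext T \<psi> t)"
    "\<Omega> (F t (z 0)) (periodic_ext T \<psi> t u) (periodic_ext T \<psi> t v) = \<Omega> (z 0) u v"
    using \<psi> by (auto simp: \<tau>(2) periodic_ext_orbit[symmetric] \<tau>(3))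
  show "periodic_ext T \<psi> 0 = id" "periodic_ext T \<psi> T = id"
    using triv T by (auto simp: periodic_symplectic_trivialization_def periodic_ext_def)
qed

abbreviation \<Phi> :: "real \<Rightarrow> 'e \<Rightarrow> 'e" where "\<Phi> \<equiv> fundamental_solution A F T z \<psi>"

lemma trivialization_fundamental_solution:
  "periodic_ext T \<psi> t (\<Phi> t v) = tangent_map A (F t) (z 0) v"
  using trivialization(2)[of t] by (simp add: fundamental_solution_def bij_is_surj surj_f_inv_f)

lemma fundamental_solution_linear: "linear (\<Phi> t)"
  unfolding fundamental_solution_def
  by (intro linear_compose linear_tangent_map orbit_all_times inj_linear_imp_inv_linear trivialization
      bij_is_inj)

lemma fundamental_solution_symplectic: "\<Omega> (z 0) (\<Phi> t u) (\<Phi> t v) = \<Omega> (z 0) u v"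
  unfolding trivialization(3)[of t, symmetric] trivialization_fundamental_solution
  unfolding trivialization(3) by (rule flow_symplectic[OF orbit_all_times])

lemma fundamental_solution_zero: "\<Phi> 0 = id"
  by (simp add: fundamental_solution_def trivialization tangent_map_zero)

text \<open>The loop closes up, so the chain rule for the flow splits the differential at the same
  base point. The trivialization has period T and is the identity at T, hence
  \<open>\<Phi> T\<close> is the differential of the return map itself.\<close>

lemma fundamental_solution_shift: "\<Phi> (t + T) = \<Phi> t \<circ> \<Phi> T"
proof -
  have "F T (z 0) = z 0" using orbit_flow(2)[of T] T closed by simp
  then have "tangent_map A (F (t + T)) (z 0) = tangent_map A (F t) (z 0) \<circ> tangent_map A (F T) (z 0)"
    using tangent_map_shift[OF X_periodic(1) orbit_all_times orbit_all_times] by simp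
  then show ?thesis
    using T by (simp add: fundamental_solution_def trivialization periodic_ext_shift o_assoc)
qed

text \<open>The inverse of the trivialization is avoided: its symplecticity moves it to the other
  argument, so that pairing \<open>\<Phi> t v\<close> with w becomes pairing the differential of the
  flow with \<psi> applied to w. All ingredients of that are continuous in a fixed chart, and by
  nondegeneracy every coordinate of \<open>\<Phi> t v\<close> is such a pairing.\<close>

lemma fundamental_solution_continuous: "continuous_on UNIV (\<lambda>t. \<Phi> t v)"
proof -
  let ?c = "chart_at A (z 0)"
  let ?y = "cmap ?c (z 0)"
  have inv: "cinv ?c ?y = z 0" by (rule chart(5)[OF chart_at_in mem_chart_at])
  have pair: "continuous_on UNIV (\<lambda>t. \<Omega> (z 0) (\<Phi> t v) w)" for w
  proof -
    have "isCont (\<lambda>t. \<Omega> (z 0) (\<Phi> t v) w) t" for t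
    proof -
      let ?d = "chart_at A (F t (z 0))"
      let ?f = "flow_rep ?c ?d"
      define S where "S = {s. F s (z 0) \<in> cdom ?d}"
      have S_eq: "S = (\<lambda>s. (s, ?y)) -` flow_dom ?c ?d"
        using orbit_all_times mem_chart_at by (auto simp: S_def flow_dom_def inv)
      have oS: "open S" unfolding S_eq
        by (intro open_vimage open_flow_dom chart_at_in continuous_intros)
      have path: "continuous_on S (\<lambda>s. (s, ?y))" "(\<lambda>s. (s, ?y)) ` S \<subseteq> flow_dom ?c ?d"
        by (auto intro!: continuous_intros simp: S_eq)
      note smooth = smooth_flow_rep[OF chart_at_in chart_at_in, of "z 0" "F t (z 0)"]
      have f: "continuous_on S (\<lambda>s. ?f (s, ?y))"
        by (rule continuous_on_compose2[OF smooth_on_continuous[OF smooth] path])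
      have f_in: "?f (s, ?y) \<in> cimg ?d" if "s \<in> S" for s
        using that by (simp add: flow_rep_def S_def inv)
      have df: "continuous_on S (\<lambda>s. frechet_derivative ?f (at (s, ?y)) (0, v))"
        by (rule continuous_on_compose2[OF smooth_on_continuous_derivative[OF smooth] path])
      have "smooth_on {t. periodic_ext T z t \<in> cdom ?d}
          (\<lambda>t. to_chart A ?d (periodic_ext T z t) (periodic_ext T \<psi> t w))"
        using triv chart_at_in unfolding periodic_symplectic_trivialization_def by blast
      from smooth_on_continuous[OF this]
      have \<psi>: "continuous_on S (\<lambda>t. to_chart A ?d (F t (z 0)) (periodic_ext T \<psi> t w))"
        by (simp add: periodic_ext_orbit S_def)
      have form: "continuous_on S (\<lambda>s. form_in_chart A \<Omega> ?d (?f (s, ?y)) i j)" for i j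
      proof (rule continuous_on_compose2[OF _ f])
        have "smooth_on (cimg ?d) (\<lambda>y. form_in_chart A \<Omega> ?d y i j)"
          using sympl chart_at_in unfolding symplectic_manifold_def by blast
        then show "continuous_on (cimg ?d) (\<lambda>y. form_in_chart A \<Omega> ?d y i j)"
          by (rule smooth_on_continuous)
      qed (use f_in in auto)
      have cont: "continuous_on S (\<lambda>s. \<Sum>i\<in>Basis. \<Sum>j\<in>Basis. form_in_chart A \<Omega> ?d (?f (s, ?y)) i j
          * (frechet_derivative ?f (at (s, ?y)) (0, v) \<bullet> i)
          * (to_chart A ?d (F s (z 0)) (periodic_ext T \<psi> s w) \<bullet> j))"
        by (intro continuous_intros form df \<psi>)
      have eq: "\<Omega> (z 0) (\<Phi> s v) w = (\<Sum>i\<in>Basis. \<Sum>j\<in>Basis. form_in_chart A \<Omega> ?d (?f (s, ?y)) i j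
          * (frechet_derivative ?f (at (s, ?y)) (0, v) \<bullet> i)
          * (to_chart A ?d (F s (z 0)) (periodic_ext T \<psi> s w) \<bullet> j))" if s: "s \<in> S" for s
      proof -
        have "\<Omega> (z 0) (\<Phi> s v) w
            = \<Omega> (F s (z 0)) (tangent_map A (F s) (z 0) v) (periodic_ext T \<psi> s w)"
          using trivialization(3)[of s "\<Phi> s v" w] by (simp add: trivialization_fundamental_solution)
        also have "\<dots> = form_in_chart A \<Omega> ?d (?f (s, ?y)) (frechet_derivative ?f (at (s, ?y)) (0, v))
            (to_chart A ?d (F s (z 0)) (periodic_ext T \<psi> s w))"
          using s by (intro form_in_chart_flow orbit_all_times chart_at_in) (simp add: S_def)
        also have "\<dots> = (\<Sum>i\<in>Basis. \<Sum>j\<in>Basis. form_in_chart A \<Omega> ?d (?f (s, ?y)) i j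
          * (frechet_derivative ?f (at (s, ?y)) (0, v) \<bullet> i)
          * (to_chart A ?d (F s (z 0)) (periodic_ext T \<psi> s w) \<bullet> j))"
          by (rule bilinear_basis_expansion[OF bilinear_form_in_chart[OF chart_at_in f_in[OF s]]])
        finally show ?thesis .
      qed
      have "continuous_on S (\<lambda>t. \<Omega> (z 0) (\<Phi> t v) w)"
        by (rule continuous_on_eq[OF cont]) (rule eq[symmetric])
      moreover have "t \<in> S" by (simp add: S_def mem_chart_at)
      ultimately show ?thesis using oS by (simp add: continuous_on_eq_continuous_at)
    qed
    then show ?thesis by (simp add: continuous_on_eq_continuous_at)
  qed
  have comp: "continuous_on UNIV (\<lambda>t. \<Phi> t v \<bullet> b)" for b
  proof -
    \<comment> \<open>The representing vector w sits in the first slot; the sign compensates for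
      moving it to the second.\<close>
    have "linear (\<lambda>u. - (u \<bullet> b))" by (rule linearI) (simp_all add: inner_add_left)
    then obtain w where w: "\<And>u. \<Omega> (z 0) w u = - (u \<bullet> b)"
      using symplectic_form_represents[OF symplectic_form_at] by blast
    have "u \<bullet> b = \<Omega> (z 0) u w" for u
      using w symplectic_form_antisym[OF symplectic_form_at, of "z 0" u w] by simp
    then show ?thesis using pair by simp
  qed
  show ?thesis by (rule continuous_on_componentwise[THEN iffD2], rule ballI, rule comp)
qed

end

section \<open>Growth of the index under iteration\<close>

theorem corollary4p7:
  fixes A :: "('m::{t2_space, second_countable_topology}, 'e::euclidean_space) chart set"
    and \<Omega> :: "'m \<Rightarrow> 'e \<Rightarrow> 'e \<Rightarrow> real"
    and n :: nat
    and H :: "'m \<times> real \<Rightarrow> real"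
    and T :: real
    and z :: "real \<Rightarrow> 'm"
    and D :: "(real \<times> 'm) set"
    and F :: "real \<Rightarrow> 'm \<Rightarrow> 'm"
    and \<psi> :: "real \<Rightarrow> 'e \<Rightarrow> 'e"
    and L0 :: "'e set"
    and \<mu> :: "(real \<Rightarrow> 'e set) \<Rightarrow> int"
  assumes "symplectic_manifold A \<Omega>"
    and "DIM('e) = 2 * n"
    and "smooth_hamiltonian A H"
    and "T > 0"
    and "\<forall>p t. H (p, t + T) = H (p, t)"
    and "integral_curve_on A (hamiltonian_vf A \<Omega> H) {0..T} z"
    and "z 0 = z T"
    and "maximal_flow A (hamiltonian_vf A \<Omega> H) D F"
    and "periodic_symplectic_trivialization A \<Omega> T z \<psi>"
    and "lagrangian (\<Omega> (z 0)) L0"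
    and "is_maslov_index (\<Omega> (z 0)) L0 \<mu>"
  shows "(\<forall>N\<ge>1. \<bar>iterate_maslov_index \<mu> A F T z \<psi> L0 N
                   - int N * iterate_maslov_index \<mu> A F T z \<psi> L0 1\<bar> \<le> int (n * (7 * N + 5)))
       \<and> (\<exists>a b :: real. \<forall>N\<ge>1. real_of_int \<bar>iterate_maslov_index \<mu> A F T z \<psi> L0 N\<bar> \<le> a * real N + b)
       \<and> (iterate_maslov_index \<mu> A F T z \<psi> L0 1 > int (7 * n) \<longrightarrow>
            (\<exists>\<alpha> \<beta> :: real. \<alpha> > 0 \<and>
               (\<forall>N\<ge>1. real_of_int (iterate_maslov_index \<mu> A F T z \<psi> L0 N) \<ge> \<alpha> * real N - \<beta>)))"
proof -
  interpret periodic_orbit A \<Omega> H D F T z \<psi>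
    using assms by unfold_locales
  define m where "m N = iterate_maslov_index \<mu> A F T z \<psi> L0 N" for N
  have bound: "\<bar>m N - int N * m 1\<bar> \<le> int (n * (7 * N + 5))" if "N \<ge> 1" for N
  proof -
    obtain k where k: "N = Suc k" using \<open>N \<ge> 1\<close> by (cases N) auto
    have "\<bar>m N - int N * m 1\<bar> \<le> 2 * int n * int k"
      using maslov_index_iterate_bound[OF symplectic_form_at assms(2,10,11) fundamental_solution_linear
          fundamental_solution_symplectic fundamental_solution_zero fundamental_solution_continuous
          fundamental_solution_shift, of k]
      by (simp add: m_def iterate_maslov_index_def k)
    also have "\<dots> = int n * (2 * int k)" by simp
    \<comment> \<open>With N = k + 1 the error 2k is well below 7N + 5.\<close>
    also have "\<dots> \<le> int n * (7 * int N + 5)" by (intro mult_left_mono) (auto simp: k)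
    finally show ?thesis by simp
  qed
  have real_bound: "\<bar>real_of_int (m N) - real N * real_of_int (m 1)\<bar> \<le> real n * (7 * real N + 5)" if "N \<ge> 1" for N
  proof -
    have "real_of_int \<bar>m N - int N * m 1\<bar> \<le> real_of_int (int (n * (7 * N + 5)))"
      using bound[OF that] of_int_le_iff by blast
    then show ?thesis by simp
  qed
  have "real_of_int \<bar>m N\<bar> \<le> (\<bar>real_of_int (m 1)\<bar> + 7 * real n) * real N + 5 * real n" if "N \<ge> 1" for N
  proof -
    have "\<bar>real_of_int (m N)\<bar> \<le> \<bar>real N * real_of_int (m 1)\<bar> + real n * (7 * real N + 5)"
      using real_bound[OF that] by linarith
    then show ?thesis by (simp add: abs_mult algebra_simps)
  qed
  \<comment> \<open>This gives the slope \<alpha> = \<open>m 1\<close> - 7n, positive exactly under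
    the stated condition, and \<beta> = 5n.\<close>
  moreover have "real_of_int (m N) \<ge> (real_of_int (m 1) - 7 * real n) * real N - 5 * real n" if "N \<ge> 1" for N
    using real_bound[OF that] by (simp add: algebra_simps abs_le_iff)
  moreover have "real_of_int (m 1) - 7 * real n > 0" if "m 1 > int (7 * n)"
    using that by linarith
  ultimately show ?thesis
    using bound unfolding m_def[symmetric] by blast
qed

end
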